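(* Let $G$ be a finite group. (1) If $p_1<p_2$ are the two smallest prime divisors of $|G|$ and $\mathrm{pr}^*(G)>(p_1+p_2-1)/(p_1p_2)$, then $G$ is nilpotent. In particular, if $\mathrm{pr}^*(G)>2/3$, then $G$ is nilpotent. (2) If $\mathrm{pr}^*(G)>2/5$, then $G$ is soluble.
   Context: For subsets $X,Y$ of a finite group $G$, $\Pr(X,Y)=|\{(x,y)\in X\times Y: xy=yx\}|/(|X||Y|)$. For sets of primes $\pi_1,\pi_2$, $\mathrm{pr}^*_G(\pi_1,\pi_2)$ denotes the maximum real number $\epsilon$ such that for every pair of distinct primes $p\in\pi_1$, $q\in\pi_2$ there exist a Sylow $p$-subgroup $P$ and a Sylow $q$-subgroup $Q$ of $G$ with $\Pr(P,Q)\ge\epsilon$ (the Sylow $p$-subgroup is taken to be trivial if $p\nmid |G|$). $\mathrm{pr}^*(G)$ denotes $\mathrm{pr}^*_G(\pi,\pi)$ for any set of primes $\pi$ containing all prime divisors of $|G|$. *)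

theory Defs
  imports "HOL-Algebra.Algebra" "HOL-Computational_Algebra.Primes"
begin

definition comm_prob :: "('a, 'b) monoid_scheme \<Rightarrow> 'a set \<Rightarrow> 'a set \<Rightarrow> real" where
  "comm_prob G A B =
     real (card {(x, y). x \<in> A \<and> y \<in> B \<and> x \<otimes>\<^bsub>G\<^esub> y = y \<otimes>\<^bsub>G\<^esub> x})
       / (real (card A) * real (card B))"

text \<open>Sylow p-subgroup of a finite group (trivial if p does not divide the order).\<close>
definition sylow_subgroup :: "('a, 'b) monoid_scheme \<Rightarrow> nat \<Rightarrow> 'a set \<Rightarrow> bool" where
  "sylow_subgroup G p P \<longleftrightarrow> subgroup P G \<and> card P = p ^ multiplicity p (order G)"

definition pr_star :: "('a, 'b) monoid_scheme \<Rightarrow> real" where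
  "pr_star G = (GREATEST \<epsilon>. \<forall>p q. Factorial_Ring.prime (p::nat) \<and> Factorial_Ring.prime (q::nat) \<and> p \<noteq> q \<longrightarrow>
       (\<exists>P Q. sylow_subgroup G p P \<and> sylow_subgroup G q Q \<and> comm_prob G P Q \<ge> \<epsilon>))"

definition commutator_subgroup :: "('a, 'b) monoid_scheme \<Rightarrow> 'a set \<Rightarrow> 'a set \<Rightarrow> 'a set" where
  "commutator_subgroup G H K = generate G
     {x \<otimes>\<^bsub>G\<^esub> y \<otimes>\<^bsub>G\<^esub> inv\<^bsub>G\<^esub> x \<otimes>\<^bsub>G\<^esub> inv\<^bsub>G\<^esub> y | x y. x \<in> H \<and> y \<in> K}"

fun lower_central_series :: "('a, 'b) monoid_scheme \<Rightarrow> nat \<Rightarrow> 'a set" where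
  "lower_central_series G 0 = carrier G"
| "lower_central_series G (Suc n) = commutator_subgroup G (lower_central_series G n) (carrier G)"

definition nilpotent_group :: "('a, 'b) monoid_scheme \<Rightarrow> bool" where
  "nilpotent_group G \<longleftrightarrow> group G \<and> (\<exists>n. lower_central_series G n = {\<one>\<^bsub>G\<^esub>})"

end

theory Submission
  imports Defs "HOL-Combinatorics.Permutations"
begin

text \<open>
  For a p-group \<open>P\<close> and a q-group \<open>Q\<close> put \<open>t = |P : C\<^sub>P(Q)|\<close>. An element of \<open>P\<close> outside \<open>C\<^sub>P(Q)\<close>
  centralizes at most \<open>|Q|/q\<close> elements of \<open>Q\<close>, so \<open>Pr(P, Q) \<le> 1/t + (1 - 1/t)/q\<close>: a lower bound on
  the commuting probability is an upper bound on the prime power \<open>t\<close>. Such bounds on \<open>t\<close> pass to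
  normal subgroups and to quotients.

  Under the hypotheses of (1) all the indices are 1. Then a central element of a Sylow p-subgroup is
  centralized by a Sylow subgroup for every prime, hence is central in the group. So every nontrivial
  quotient has a nontrivial center, and the group is nilpotent.

  Under the hypothesis of (2) one may pass to a simple factor \<open>S\<close>. The bounds show that for a prime
  \<open>r \<ge> 5\<close> the number of Sylow r-subgroups divides 6; it is 1 modulo r, so it is 1, or \<open>r = 5\<close> and it
  is 6. In the latter case \<open>S\<close> acts faithfully on 6 points, a Sylow 5-subgroup is self-centralizing
  of order 5 and \<open>|S| = 30\<close>, which is impossible. Otherwise \<open>|S|\<close> only involves the primes 2 and 3
  and the number of Sylow 3-subgroups divides 8, hence is 1 or 4; if it is 4, then \<open>|S|\<close> divides 24, so
  there are at most 3 Sylow 2-subgroups, and \<open>|S|\<close> would divide 6. In all remaining cases \<open>S\<close> is a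
  p-group.
\<close>

section \<open>Arithmetic of prime powers\<close>

lemma dvd_if_prime_powers_dvd:
  fixes n m :: nat
  assumes "n > 0" "\<And>p. Factorial_Ring.prime p \<Longrightarrow> p ^ multiplicity p n dvd m"
  shows "n dvd m"
proof (cases "m = 0")
  case False
  show ?thesis
    using assms False
    by (intro multiplicity_le_imp_dvd) (auto intro!: multiplicity_geI simp: prime_nat_iff)
qed simp

text \<open>For powers of one prime, comparing sizes is comparing divisibility. The divisibility
  hypothesis puts \<open>p ^ (c - d)\<close> into \<open>k\<close>, and the cross inequality says
  \<open>a - b\<close> is at most \<open>c - d\<close>. This lets an index divide \<open>k\<close>
  as soon as it is no larger than another index that does.\<close>

lemma prime_power_mult_le_imp_dvd:
  fixes p k a b c d :: nat
  assumes p: "Factorial_Ring.prime p" and dvd: "p ^ c dvd k * p ^ d" and "d \<le> c"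
    and le: "p ^ a * p ^ d \<le> p ^ c * p ^ b"
  shows "p ^ a dvd k * p ^ b"
proof -
  have p1: "p > 1" using p prime_gt_1_nat by blast
  have "p ^ (c - d) * p ^ d dvd k * p ^ d"
    using dvd \<open>d \<le> c\<close> by (simp flip: power_add)
  then have k: "p ^ (c - d) dvd k" using p1 by simp
  have "p ^ (a + d) \<le> p ^ (c + b)" using le by (simp add: power_add)
  then have "a + d \<le> c + b" using p1 by simp
  then have "p ^ a dvd p ^ (c - d) * p ^ b"
    using \<open>d \<le> c\<close> by (simp flip: power_add add: le_imp_power_dvd)
  with k show ?thesis by (meson dvd_trans dvd_refl mult_dvd_mono)
qed

text \<open>Read as \<open>a / d \<le> c / f\<close>: if two orders are split into image and kernel
  parts, the quotient of the first parts grows no larger than the quotient of the orders when the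
  other parts compare as \<open>e \<le> b\<close>.\<close>

lemma mult_cross_mono:
  fixes a b c d e f :: nat
  assumes "a * b = c" "d * e = f" "e \<le> b"
  shows "a * f \<le> c * d"
proof -
  have "a * d * e \<le> a * d * b" using assms(3) by simp
  then show ?thesis unfolding assms(1,2)[symmetric] by (simp add: ac_simps)
qed

section \<open>Conjugates, normalizers and centralizers\<close>

locale finite_group = group +
  assumes finite_carrier: "finite (carrier G)"

definition conj_set :: "('a, 'b) monoid_scheme \<Rightarrow> 'a \<Rightarrow> 'a set \<Rightarrow> 'a set" where
  "conj_set G g A = (\<lambda>x. g \<otimes>\<^bsub>G\<^esub> x \<otimes>\<^bsub>G\<^esub> inv\<^bsub>G\<^esub> g) ` A"

definition conjugates :: "('a, 'b) monoid_scheme \<Rightarrow> 'a set \<Rightarrow> 'a set set" where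
  "conjugates G A = {conj_set G g A | g. g \<in> carrier G}"

definition centralizer :: "('a, 'b) monoid_scheme \<Rightarrow> 'a set \<Rightarrow> 'a set" where
  "centralizer G A = {g \<in> carrier G. \<forall>a \<in> A. g \<otimes>\<^bsub>G\<^esub> a = a \<otimes>\<^bsub>G\<^esub> g}"

context group
begin

lemma conj_mult:
  assumes "g \<in> carrier G" "h \<in> carrier G" "x \<in> carrier G"
  shows "(g \<otimes> h) \<otimes> x \<otimes> inv (g \<otimes> h) = g \<otimes> (h \<otimes> x \<otimes> inv h) \<otimes> inv g"
  using assms by (simp add: inv_mult_group m_assoc)

lemma inj_on_conj: "g \<in> carrier G \<Longrightarrow> A \<subseteq> carrier G \<Longrightarrow> inj_on (\<lambda>x. g \<otimes> x \<otimes> inv g) A"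
  by (auto simp: inj_on_def subset_iff)

lemma conj_set_subset: "g \<in> carrier G \<Longrightarrow> A \<subseteq> carrier G \<Longrightarrow> conj_set G g A \<subseteq> carrier G"
  by (auto simp: conj_set_def)

lemma conj_set_one [simp]: "A \<subseteq> carrier G \<Longrightarrow> conj_set G \<one> A = A"
proof -
  assume "A \<subseteq> carrier G"
  then have "(\<lambda>x. \<one> \<otimes> x \<otimes> inv \<one>) ` A = (\<lambda>x. x) ` A"
    by (intro image_cong) auto
  then show ?thesis by (simp add: conj_set_def)
qed

lemma conj_set_mult:
  "\<lbrakk>g \<in> carrier G; h \<in> carrier G; A \<subseteq> carrier G\<rbrakk>
    \<Longrightarrow> conj_set G (g \<otimes> h) A = conj_set G g (conj_set G h A)"
  unfolding conj_set_def image_image by (intro image_cong) (auto simp: conj_mult subset_iff)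

lemma conj_set_inv:
  "\<lbrakk>g \<in> carrier G; A \<subseteq> carrier G\<rbrakk> \<Longrightarrow> conj_set G (inv g) (conj_set G g A) = A"
  using conj_set_mult[of "inv g" g A] by simp

lemma card_conj_set: "g \<in> carrier G \<Longrightarrow> A \<subseteq> carrier G \<Longrightarrow> card (conj_set G g A) = card A"
  unfolding conj_set_def by (intro card_image inj_on_conj)

lemma conj_hom: "g \<in> carrier G \<Longrightarrow> (\<lambda>x. g \<otimes> x \<otimes> inv g) \<in> hom G G"
  using inv_solve_left by (auto intro!: homI simp: m_assoc)

lemma subgroup_conj_set:
  assumes "g \<in> carrier G" "subgroup H G"
  shows "subgroup (conj_set G g H) G"
proof -
  interpret group_hom G G "\<lambda>x. g \<otimes> x \<otimes> inv g"
    using conj_hom[OF assms(1)] by unfold_locales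
  show ?thesis unfolding conj_set_def by (rule subgroup_img_is_subgroup[OF assms(2)])
qed

lemma normalizer_eq:
  assumes "A \<subseteq> carrier G"
  shows "normalizer G A = {g \<in> carrier G. conj_set G g A = A}"
  using assms unfolding normalizer_def stabilizer_def conj_set_def l_coset_def r_coset_def
  by (simp add: UNION_singleton_eq_range image_image)

lemma subgroup_normalizer: "A \<subseteq> carrier G \<Longrightarrow> subgroup (normalizer G A) G"
  by (rule normalizer_imp_subgroup)

lemma subgroup_centralizer:
  assumes "A \<subseteq> carrier G"
  shows "subgroup (centralizer G A) G"
proof (rule subgroupI)
  show "centralizer G A \<subseteq> carrier G" by (auto simp: centralizer_def)
  show "centralizer G A \<noteq> {}" using assms by (auto simp: centralizer_def intro!: exI[of _ \<one>])
next
  fix a assume a: "a \<in> centralizer G A"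
  have "inv a \<otimes> x = x \<otimes> inv a" if x: "x \<in> A" for x
  proof -
    have "x \<in> carrier G" "a \<in> carrier G" "a \<otimes> x = x \<otimes> a"
      using x a assms by (auto simp: centralizer_def)
    then show ?thesis by (metis inv_closed inv_solve_left inv_solve_right m_assoc m_closed)
  qed
  then show "inv a \<in> centralizer G A" using a by (auto simp: centralizer_def)
next
  fix a b assume a: "a \<in> centralizer G A" and b: "b \<in> centralizer G A"
  have "a \<otimes> b \<otimes> x = x \<otimes> (a \<otimes> b)" if x: "x \<in> A" for x
  proof -
    have "x \<in> carrier G" "a \<in> carrier G" "b \<in> carrier G" "a \<otimes> x = x \<otimes> a" "b \<otimes> x = x \<otimes> b"
      using x a b assms by (auto simp: centralizer_def)
    then show ?thesis by (metis m_assoc)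
  qed
  then show "a \<otimes> b \<in> centralizer G A" using a b by (auto simp: centralizer_def)
qed

lemma centralizer_subset_normalizer:
  assumes "A \<subseteq> carrier G"
  shows "centralizer G A \<subseteq> normalizer G A"
proof
  fix g assume g: "g \<in> centralizer G A"
  have "(\<lambda>x. g \<otimes> x \<otimes> inv g) ` A = (\<lambda>x. x) ` A"
  proof (rule image_cong)
    fix x assume x: "x \<in> A"
    then have "g \<otimes> x = x \<otimes> g" "g \<in> carrier G" "x \<in> carrier G"
      using g assms by (auto simp: centralizer_def)
    then show "g \<otimes> x \<otimes> inv g = x" by (simp add: m_assoc)
  qed simp
  then show "g \<in> normalizer G A"
    using g assms by (auto simp: normalizer_eq conj_set_def centralizer_def)
qed

lemma conj_set_self:
  assumes "subgroup H G" "h \<in> H"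
  shows "conj_set G h H = H"
proof -
  interpret H: subgroup H G by fact
  show ?thesis
  proof
    show sub: "conj_set G h H \<subseteq> H" using assms(2) by (auto simp: conj_set_def)
    show "H \<subseteq> conj_set G h H"
    proof
      fix x assume x: "x \<in> H"
      then have "inv h \<otimes> x \<otimes> h \<in> H" using assms(2) by auto
      moreover have "h \<otimes> (inv h \<otimes> x \<otimes> h) \<otimes> inv h = x"
        using x assms(2) by (intro conjugation_is_surj) auto
      ultimately show "x \<in> conj_set G h H" unfolding conj_set_def by (metis image_eqI)
    qed
  qed
qed

lemma subgroup_subset_normalizer: "subgroup H G \<Longrightarrow> H \<subseteq> normalizer G H"
  using conj_set_self by (auto simp: normalizer_eq subgroup.subset subgroup.mem_carrier)

lemma normal_iff_normalizer:
  assumes "subgroup H G"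
  shows "H \<lhd> G \<longleftrightarrow> normalizer G H = carrier G"
proof
  assume n: "normalizer G H = carrier G"
  show "H \<lhd> G" unfolding normal_inv_iff
  proof (intro conjI assms ballI)
    fix x h assume "x \<in> carrier G" "h \<in> H"
    then have "conj_set G x H = H"
      using n assms by (auto simp: normalizer_eq subgroup.subset)
    then show "x \<otimes> h \<otimes> inv x \<in> H" using \<open>h \<in> H\<close> by (auto simp: conj_set_def)
  qed
next
  assume n: "H \<lhd> G"
  interpret normal H G by fact
  have "conj_set G x H = H" if x: "x \<in> carrier G" for x
  proof
    show "conj_set G x H \<subseteq> H" using x n by (auto simp: conj_set_def inv_op_closed2)
    show "H \<subseteq> conj_set G x H"
    proof
      fix y assume y: "y \<in> H"
      then have "inv x \<otimes> y \<otimes> x \<in> H" using x by (simp add: inv_op_closed1)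
      moreover have "x \<otimes> (inv x \<otimes> y \<otimes> x) \<otimes> inv x = y"
        using x y by (intro conjugation_is_surj) auto
      ultimately show "y \<in> conj_set G x H" unfolding conj_set_def by (metis image_eqI)
    qed
  qed
  then show "normalizer G H = carrier G" using assms by (auto simp: normalizer_eq subgroup.subset)
qed

lemma centralizer_conj_set:
  assumes g: "g \<in> carrier G" and A: "A \<subseteq> carrier G"
  shows "centralizer G (conj_set G g A) = conj_set G g (centralizer G A)"
proof -
  have *: "conj_set G g (centralizer G A) \<subseteq> centralizer G (conj_set G g A)"
    if "g \<in> carrier G" "A \<subseteq> carrier G" for g A
  proof
    interpret c: group_hom G G "\<lambda>x. g \<otimes> x \<otimes> inv g"
      using conj_hom[OF that(1)] by unfold_locales
    fix y assume "y \<in> conj_set G g (centralizer G A)"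
    then obtain c where c: "c \<in> centralizer G A" "y = g \<otimes> c \<otimes> inv g"
      by (auto simp: conj_set_def)
    have "y \<otimes> (g \<otimes> a \<otimes> inv g) = (g \<otimes> a \<otimes> inv g) \<otimes> y" if "a \<in> A" for a
      using c that \<open>A \<subseteq> carrier G\<close> by (auto simp: centralizer_def simp flip: c.hom_mult)
    then show "y \<in> centralizer G (conj_set G g A)"
      using c that by (auto simp: centralizer_def conj_set_def)
  qed
  have sub: "centralizer G B \<subseteq> carrier G" for B by (auto simp: centralizer_def)
  \<comment> \<open>The reverse inclusion is \<open>*\<close> for \<open>inv g\<close> and the
    conjugated set, carried back by \<open>g\<close>.\<close>
  have "centralizer G (conj_set G g A)
      = conj_set G g (conj_set G (inv g) (centralizer G (conj_set G g A)))"
    using conj_set_mult[of g "inv g"] g sub by simp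
  also have "\<dots> \<subseteq> conj_set G g (centralizer G A)"
    using *[of "inv g" "conj_set G g A"] g A conj_set_inv[of g A] conj_set_subset[OF g A]
    by (force simp: conj_set_def)
  finally show ?thesis using *[OF g A] by blast
qed

section \<open>Group actions\<close>

text \<open>Elements of \<open>Bij M\<close> are extensional, so an action given by a total function
  must be cut down to \<open>M\<close>. Bijectivity comes for free, the inverse being the action of
  \<open>inv g\<close>.\<close>

lemma group_action_restrictI:
  assumes cl: "\<And>g x. g \<in> carrier G \<Longrightarrow> x \<in> M \<Longrightarrow> act g x \<in> M"
    and one: "\<And>x. x \<in> M \<Longrightarrow> act \<one> x = x"
    and mult: "\<And>g h x. \<lbrakk>g \<in> carrier G; h \<in> carrier G; x \<in> M\<rbrakk> \<Longrightarrow> act (g \<otimes> h) x = act g (act h x)"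
  shows "group_action G M (\<lambda>g. \<lambda>x\<in>M. act g x)"
proof -
  have bij: "(\<lambda>x\<in>M. act g x) \<in> Bij M" if g: "g \<in> carrier G" for g
  proof -
    have 1: "act (inv g) (act g x) = x" if "x \<in> M" for x
      using mult[of "inv g" g x] g that by (simp add: one)
    have 2: "act g (act (inv g) x) = x" if "x \<in> M" for x
      using mult[of g "inv g" x] g that by (simp add: one)
    have "bij_betw (act g) M M"
      by (rule bij_betw_byWitness[where f' = "act (inv g)"]) (use 1 2 g cl in auto)
    then show ?thesis by (simp add: Bij_def cong: bij_betw_cong)
  qed
  have "(\<lambda>g. \<lambda>x\<in>M. act g x) \<in> hom G (BijGroup M)"
    using bij cl mult
    by (auto intro!: homI simp: BijGroup_def compose_def intro!: restrict_ext)
  then show ?thesis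
    by (simp add: group_action_def group_hom_def group_hom_axioms_def group_BijGroup is_group)
qed

end

text \<open>Orbit sizes divide \<open>p ^ k\<close>, so an orbit that is not a single point has size
  divisible by \<open>p\<close>. Summing over the orbits, only the fixed points survive modulo
  \<open>p\<close>.\<close>

lemma (in group_action) prime_power_fixed_points:
  assumes p: "Factorial_Ring.prime (p::nat)" and ord: "order G = p ^ k" and fin: "finite E"
  shows "card E mod p = card {x \<in> E. \<forall>g \<in> carrier G. \<phi> g x = x} mod p"
proof -
  interpret G: group G using group_hom group_hom.axioms(1) by auto
  define F where "F = {x \<in> E. \<forall>g \<in> carrier G. \<phi> g x = x}"
  define O1 where "O1 = {orb \<in> orbits G E \<phi>. card orb = 1}"
  define O2 where "O2 = {orb \<in> orbits G E \<phi>. card orb \<noteq> 1}"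
  have orbE: "orb \<subseteq> E" if "orb \<in> orbits G E \<phi>" for orb
    using that orbits_coverture by blast
  have fino: "finite (orbits G E \<phi>)"
    using fin orbE by (meson PowI finite_Pow_iff finite_subset subsetI)
  have single: "orbit G \<phi> x = {x}" if "x \<in> F" for x
    using that orbit_refl[of x] by (auto simp: F_def orbit_def)
  have O1: "O1 = (\<lambda>x. {x}) ` F"
  proof (intro equalityI subsetI)
    fix orb assume "orb \<in> O1"
    then obtain x where x: "x \<in> E" "orb = orbit G \<phi> x" "card orb = 1"
      by (auto simp: O1_def orbits_def)
    then have "orb = {x}" using orbit_refl[OF x(1)] by (auto simp: card_Suc_eq)
    then have "\<phi> g x = x" if "g \<in> carrier G" for g
      using that x(2) by (auto simp: orbit_def)
    then show "orb \<in> (\<lambda>x. {x}) ` F" using x \<open>orb = {x}\<close> by (auto simp: F_def)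
  next
    fix orb assume "orb \<in> (\<lambda>x. {x}) ` F"
    then show "orb \<in> O1"
      using single by (auto simp: O1_def orbits_def F_def)
  qed
  have dvd: "p dvd card orb" if orb: "orb \<in> O2" for orb
  proof -
    obtain x where x: "x \<in> E" "orb = orbit G \<phi> x" and c: "card orb \<noteq> 1"
      using orb by (auto simp: O2_def orbits_def)
    have "card orb dvd p ^ k"
      using orbit_stabilizer_theorem[OF x(1)] x(2) ord by (metis dvd_triv_left)
    then obtain i where "card orb = p ^ i" using divides_primepow_nat[OF p] by blast
    then show ?thesis using c by (cases i) auto
  qed
  have "card E = (\<Sum>orb\<in>orbits G E \<phi>. card orb)"
    using disjoint_sum[OF fin, of "\<lambda>_. 1::nat"] by simp
  also have "\<dots> = (\<Sum>orb\<in>O1. card orb) + (\<Sum>orb\<in>O2. card orb)"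
  proof -
    have "orbits G E \<phi> = O1 \<union> O2" "O1 \<inter> O2 = {}" by (auto simp: O1_def O2_def)
    moreover have "finite O1" "finite O2" using fino by (auto simp: O1_def O2_def)
    ultimately show ?thesis by (simp add: sum.union_disjoint)
  qed
  also have "(\<Sum>orb\<in>O1. card orb) = card F"
    unfolding O1 by (subst sum.reindex) (auto simp: inj_on_def)
  finally have "card E = card F + (\<Sum>orb\<in>O2. card orb)" .
  moreover have "p dvd (\<Sum>orb\<in>O2. card orb)" using dvd by (rule dvd_sum)
  ultimately show ?thesis unfolding F_def[symmetric] by auto
qed

text \<open>The first isomorphism theorem for the restriction of \<open>h\<close> to
  \<open>P\<close>, followed by Lagrange.\<close>

lemma (in group_hom) card_image_mult_card_kernel:
  assumes P: "subgroup P G"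
  shows "card (h ` P) * card (P \<inter> kernel G H h) = card P"
proof -
  interpret P: group "G\<lparr>carrier := P\<rparr>" using G.subgroup_imp_group[OF P] .
  have HP: "subgroup (h ` P) H" using subgroup_img_is_subgroup[OF P] .
  interpret HP: group "H\<lparr>carrier := h ` P\<rparr>" using H.subgroup_imp_group[OF HP] .
  have "P \<subseteq> carrier G" using P subgroup.subset by blast
  then interpret r: group_hom "G\<lparr>carrier := P\<rparr>" "H\<lparr>carrier := h ` P\<rparr>" h
    by unfold_locales (auto simp: hom_def subset_iff)
  have k: "kernel (G\<lparr>carrier := P\<rparr>) (H\<lparr>carrier := h ` P\<rparr>) h = P \<inter> kernel G H h"
    using \<open>P \<subseteq> carrier G\<close> by (auto simp: kernel_def)
  have "card (carrier (G\<lparr>carrier := P\<rparr> Mod (P \<inter> kernel G H h))) = card (h ` P)"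
    using r.FactGroup_iso_set unfolding k by (auto simp: iso_def dest: bij_betw_same_card)
  then have "card (rcosets\<^bsub>G\<lparr>carrier := P\<rparr>\<^esub> (P \<inter> kernel G H h)) = card (h ` P)"
    by (simp add: FactGroup_def)
  then show ?thesis
    using P.lagrange[OF r.subgroup_kernel] unfolding k by (simp add: order_def)
qed

section \<open>Sylow subgroups\<close>

context finite_group
begin

lemma order_pos: "order G > 0"
  using finite_carrier one_closed by (auto simp: order_def card_gt_0_iff)

lemma finite_subset_carrier: "A \<subseteq> carrier G \<Longrightarrow> finite A"
  using finite_carrier finite_subset by blast

lemma card_subgroup_dvd:
  assumes "subgroup H G" shows "card H dvd order G"
  unfolding lagrange[OF assms, symmetric] by simp

lemma card_subgroup_dvd_card_subgroup:
  assumes "subgroup H G" "subgroup K G" "H \<subseteq> K"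
  shows "card H dvd card K"
proof -
  have "card (rcosets\<^bsub>G\<lparr>carrier := K\<rparr>\<^esub> H) * card H = card K"
    using group.lagrange[OF subgroup_imp_group[OF assms(2)] subgroup_incl[OF assms]]
    by (simp add: order_def)
  then show ?thesis by (metis dvd_triv_right)
qed

lemma card_subgroup_pos:
  assumes "subgroup H G" shows "card H > 0"
  using assms finite_subset_carrier[OF subgroup.subset] subgroup.one_closed[OF assms]
  by (auto simp: card_gt_0_iff)

lemma card_subgroup_eq_order:
  assumes "subgroup H G" "order G dvd card H"
  shows "H = carrier G"
proof (rule card_subset_eq[OF finite_carrier])
  show "H \<subseteq> carrier G" using assms(1) by (rule subgroup.subset)
  show "card H = card (carrier G)"
    using dvd_antisym[OF card_subgroup_dvd[OF assms(1)] assms(2)] by (simp add: order_def)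
qed

lemma subgroup_eq_one_if_card_one:
  assumes "subgroup H G" "card H = 1" shows "H = {\<one>}"
  using assms(2) subgroup.one_closed[OF assms(1)] by (auto simp: card_Suc_eq)

lemma sylow_subgroup_exists:
  assumes "Factorial_Ring.prime (p::nat)"
  shows "\<exists>P. sylow_subgroup G p P"
proof -
  obtain m where "order G = p ^ multiplicity p (order G) * m"
    using multiplicity_dvd[of p "order G"] by (auto simp: dvd_def)
  then show ?thesis
    using sylow_thm[OF assms is_group _ finite_carrier] by (auto simp: sylow_subgroup_def)
qed

lemma card_conjugates:
  assumes "A \<subseteq> carrier G"
  shows "card (conjugates G A) * card (normalizer G A) = order G"
proof -
  interpret act: group_action G "{H. H \<subseteq> carrier G}"
    "\<lambda>g. \<lambda>H\<in>{H. H \<subseteq> carrier G}. g <# H #> inv g"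
    by (rule action_by_conjugation_on_power_set)
  have "g <# A #> inv g = conj_set G g A" for g
    unfolding conj_set_def l_coset_def r_coset_def
    by (simp add: UNION_singleton_eq_range image_image)
  then have "orbit G (\<lambda>g. \<lambda>H\<in>{H. H \<subseteq> carrier G}. g <# H #> inv g) A = conjugates G A"
    using assms by (simp add: orbit_def conjugates_def)
  then show ?thesis
    using act.orbit_stabilizer_theorem[of A] assms by (simp add: normalizer_def)
qed

lemma finite_conjugates: "finite (conjugates G A)"
  using finite_carrier by (simp add: conjugates_def setcompr_eq_image)

lemma self_in_conjugates: "A \<subseteq> carrier G \<Longrightarrow> A \<in> conjugates G A"
  unfolding conjugates_def by (rule CollectI, rule exI[of _ \<one>]) simp

lemma conj_set_in_conjugates:
  assumes "A \<subseteq> carrier G" "B \<in> conjugates G A" "g \<in> carrier G"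
  shows "conj_set G g B \<in> conjugates G A"
proof -
  obtain h where h: "h \<in> carrier G" "B = conj_set G h A"
    using assms(2) by (auto simp: conjugates_def)
  then have "conj_set G g B = conj_set G (g \<otimes> h) A" using assms by (simp add: conj_set_mult)
  then show ?thesis using h assms(3) by (auto simp: conjugates_def)
qed

lemma conjugates_subset: "A \<subseteq> carrier G \<Longrightarrow> B \<in> conjugates G A \<Longrightarrow> B \<subseteq> carrier G"
  using conj_set_subset by (auto simp: conjugates_def)

lemma sylow_subgroup_conj_set:
  "g \<in> carrier G \<Longrightarrow> sylow_subgroup G p P \<Longrightarrow> sylow_subgroup G p (conj_set G g P)"
  by (auto simp: sylow_subgroup_def subgroup_conj_set card_conj_set subgroup.subset)

lemma sylow_subgroup_conjugates:
  "Q \<in> conjugates G P \<Longrightarrow> sylow_subgroup G p P \<Longrightarrow> sylow_subgroup G p Q"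
  using sylow_subgroup_conj_set by (auto simp: conjugates_def)

text \<open>Let \<open>N\<close> be the normalizer of \<open>Q\<close>. The image of
  \<open>P\<close> in \<open>N / Q\<close> has order \<open>p ^ i\<close>, and
  \<open>|N / Q| * |Q|\<close> divides \<open>|G|\<close>. Since \<open>Q\<close> already carries
  the full p-part of \<open>|G|\<close>, the exponent \<open>i\<close> is 0, so \<open>P\<close>
  lies in the kernel \<open>Q\<close>.\<close>

lemma prime_power_subgroup_normalizing_sylow:
  assumes p: "Factorial_Ring.prime (p::nat)" and P: "subgroup P G" "card P = p ^ k"
    and Q: "sylow_subgroup G p Q" and PN: "P \<subseteq> normalizer G Q"
  shows "P \<subseteq> Q"
proof -
  define N where "N = normalizer G Q"
  have subQ: "subgroup Q G" using Q by (simp add: sylow_subgroup_def)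
  have subN: "subgroup N G" unfolding N_def by (simp add: subgroup_normalizer subgroup.subset subQ)
  interpret N: group "G\<lparr>carrier := N\<rparr>" using subgroup_imp_group[OF subN] .
  have QN: "Q \<subseteq> N" unfolding N_def using subgroup_subset_normalizer[OF subQ] .
  have subQN: "subgroup Q (G\<lparr>carrier := N\<rparr>)" using subgroup_incl[OF subQ subN QN] .
  have "Q \<lhd> G\<lparr>carrier := N\<rparr>"
    unfolding N.normal_inv_iff
  proof (intro conjI subQN ballI)
    fix x h assume x: "x \<in> carrier (G\<lparr>carrier := N\<rparr>)" and h: "h \<in> Q"
    then have "x \<in> N" by simp
    then have "x \<otimes> h \<otimes> inv x \<in> Q"
      using h subQ unfolding N_def by (auto simp: normalizer_eq subgroup.subset conj_set_def)
    then show "x \<otimes>\<^bsub>G\<lparr>carrier := N\<rparr>\<^esub> h \<otimes>\<^bsub>G\<lparr>carrier := N\<rparr>\<^esub> inv\<^bsub>G\<lparr>carrier := N\<rparr>\<^esub> x \<in> Q"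
      using m_inv_consistent[OF subN \<open>x \<in> N\<close>] by simp
  qed
  then interpret Q: normal Q "G\<lparr>carrier := N\<rparr>" .
  interpret q: group_hom "G\<lparr>carrier := N\<rparr>" "G\<lparr>carrier := N\<rparr> Mod Q" "\<lambda>a. Q #>\<^bsub>G\<lparr>carrier := N\<rparr>\<^esub> a"
    by (intro group_hom.intro group_hom_axioms.intro N.is_group Q.factorgroup_is_group
        Q.r_coset_hom_Mod)
  let ?h = "\<lambda>a. Q #>\<^bsub>G\<lparr>carrier := N\<rparr>\<^esub> a"
  have ker: "kernel (G\<lparr>carrier := N\<rparr>) (G\<lparr>carrier := N\<rparr> Mod Q) ?h \<inter> P = Q \<inter> P"
    using PN N.coset_join2[OF _ subQN] N.coset_join1[OF _ _ subQN] Q.subset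
    unfolding N_def[symmetric] by (auto simp: kernel_def FactGroup_def)
  have subP: "subgroup P (G\<lparr>carrier := N\<rparr>)" using subgroup_incl P(1) subN PN N_def by blast
  have "card (?h ` P) * card (P \<inter> Q) = card P"
    using q.card_image_mult_card_kernel[OF subP] ker by (simp add: Int_commute)
  then have "card (?h ` P) dvd p ^ k" by (metis P(2) dvd_triv_left)
  then obtain i where i: "card (?h ` P) = p ^ i" using divides_primepow_nat[OF p] by blast
  have "card (?h ` P) dvd order (G\<lparr>carrier := N\<rparr> Mod Q)"
    using q.H.lagrange[OF q.subgroup_img_is_subgroup[OF subP]] by (metis dvd_triv_right)
  moreover have "order (G\<lparr>carrier := N\<rparr> Mod Q) * card Q = card N"
    using N.lagrange[OF subQN] by (simp add: order_def FactGroup_def)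
  ultimately have "p ^ i * card Q dvd card N" using i by (metis dvd_refl mult_dvd_mono)
  also have "card N dvd order G" using card_subgroup_dvd[OF subN] .
  finally have "p ^ (i + multiplicity p (order G)) dvd order G"
    using Q by (simp add: sylow_subgroup_def power_add)
  then have "i + multiplicity p (order G) \<le> multiplicity p (order G)"
    using p order_pos by (intro multiplicity_geI) (auto simp: prime_nat_iff)
  then have "i = 0" by simp
  with i have 1: "card (?h ` P) = 1" by simp
  have "?h ` P = {Q}"
  proof -
    obtain z where z: "?h ` P = {z}" using 1 by (rule card_1_singletonE)
    have "?h \<one> = Q" using N.coset_join2[OF _ subQN, of \<one>] subgroup.one_closed[OF subN]
      subgroup.one_closed[OF subQ] by simp
    moreover have "?h \<one> \<in> ?h ` P" using subgroup.one_closed[OF P(1)] by (rule imageI)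
    ultimately show ?thesis using z by simp
  qed
  then have "x \<in> kernel (G\<lparr>carrier := N\<rparr>) (G\<lparr>carrier := N\<rparr> Mod Q) ?h \<inter> P" if "x \<in> P" for x
    using that PN by (auto simp: kernel_def FactGroup_def N_def)
  then show ?thesis unfolding ker by auto
qed

text \<open>\<open>P\<close> acts on the class of \<open>A\<close> by conjugation, and the fixed
  members are exactly those that \<open>P\<close> normalizes.\<close>

lemma conjugates_fixed_points:
  assumes p: "Factorial_Ring.prime (p::nat)" and P: "subgroup P G" "card P = p ^ k"
    and A: "A \<subseteq> carrier G"
  shows "card (conjugates G A) mod p
    = card {B \<in> conjugates G A. P \<subseteq> normalizer G B} mod p"
proof -
  interpret P: group "G\<lparr>carrier := P\<rparr>" using subgroup_imp_group[OF P(1)] .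
  have PG: "P \<subseteq> carrier G" using P(1) subgroup.subset by blast
  interpret act: group_action "G\<lparr>carrier := P\<rparr>" "conjugates G A"
    "\<lambda>g. \<lambda>B\<in>conjugates G A. conj_set G g B"
    by (rule P.group_action_restrictI)
      (use PG A conj_set_in_conjugates conjugates_subset conj_set_mult in \<open>auto simp: subset_iff\<close>)
  have "{B \<in> conjugates G A. P \<subseteq> normalizer G B}
      = {B \<in> conjugates G A. \<forall>g\<in>carrier (G\<lparr>carrier := P\<rparr>). (\<lambda>B\<in>conjugates G A. conj_set G g B) B = B}"
    using PG A conjugates_subset by (auto simp: normalizer_eq subset_iff)
  then show ?thesis
    using act.prime_power_fixed_points[OF p _ finite_conjugates, of k] P(2)
    by (simp add: order_def)
qed

lemma card_conjugates_dvd_index: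
  assumes "A \<subseteq> carrier G" "subgroup H G" "H \<subseteq> normalizer G A"
  shows "card (conjugates G A) * card H dvd order G"
  unfolding card_conjugates[OF assms(1), symmetric]
  by (intro mult_dvd_mono dvd_refl card_subgroup_dvd_card_subgroup subgroup_normalizer assms)

text \<open>The class size is the index of the normalizer, which divides \<open>|G : P|\<close>. A
  further factor \<open>p\<close> would exceed the multiplicity of \<open>p\<close> in
  \<open>|G|\<close>.\<close>

lemma prime_not_dvd_card_conjugates_sylow:
  assumes p: "Factorial_Ring.prime (p::nat)" and P: "sylow_subgroup G p P"
  shows "\<not> p dvd card (conjugates G P)"
proof
  assume "p dvd card (conjugates G P)"
  then have "p * card P dvd card (conjugates G P) * card P" by (rule mult_dvd_mono) simp
  also have "\<dots> dvd order G"
    using P by (intro card_conjugates_dvd_index subgroup_subset_normalizer)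
      (auto simp: sylow_subgroup_def subgroup.subset)
  finally have "p ^ Suc (multiplicity p (order G)) dvd order G"
    using P by (simp add: sylow_subgroup_def)
  then have "Suc (multiplicity p (order G)) \<le> multiplicity p (order G)"
    using p order_pos by (intro multiplicity_geI) (auto simp: prime_nat_iff)
  then show False by simp
qed

text \<open>The class of \<open>Q\<close> has size prime to \<open>p\<close>, so \<open>P\<close>
  normalizes some member of it. A p-subgroup normalizing a Sylow p-subgroup lies inside it, and the
  orders agree.\<close>

theorem sylow_subgroups_conjugate:
  assumes p: "Factorial_Ring.prime (p::nat)" and P: "sylow_subgroup G p P" and Q: "sylow_subgroup G p Q"
  shows "P \<in> conjugates G Q"
proof -
  have P': "subgroup P G" "card P = p ^ multiplicity p (order G)"
    and Q': "Q \<subseteq> carrier G" "card Q = card P"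
    using P Q by (auto simp: sylow_subgroup_def subgroup.subset)
  have "card {B \<in> conjugates G Q. P \<subseteq> normalizer G B} \<noteq> 0"
    using conjugates_fixed_points[OF p P' Q'(1)] prime_not_dvd_card_conjugates_sylow[OF p Q]
    by (metis dvd_eq_mod_eq_0 mod_0)
  then have "{B \<in> conjugates G Q. P \<subseteq> normalizer G B} \<noteq> {}" by (metis card.empty)
  then obtain B where B: "B \<in> conjugates G Q" "P \<subseteq> normalizer G B" by blast
  have sB: "sylow_subgroup G p B" using sylow_subgroup_conjugates[OF B(1) Q] .
  have "P \<subseteq> B" using prime_power_subgroup_normalizing_sylow[OF p P' sB B(2)] .
  moreover have "card B = card P" using sB P by (simp add: sylow_subgroup_def)
  moreover have "finite B" using finite_subset_carrier conjugates_subset[OF Q'(1) B(1)] by blast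
  ultimately show ?thesis using B(1) by (metis card_subset_eq)
qed

text \<open>Acting on its own class, \<open>P\<close> fixes only itself: a member it normalizes
  contains it and has the same order.\<close>

theorem card_conjugates_sylow_cong_1:
  assumes p: "Factorial_Ring.prime (p::nat)" and P: "sylow_subgroup G p P"
  shows "card (conjugates G P) mod p = 1"
proof -
  have P': "subgroup P G" "card P = p ^ multiplicity p (order G)"
    using P by (auto simp: sylow_subgroup_def)
  have PG: "P \<subseteq> carrier G" using P' subgroup.subset by blast
  have "{B \<in> conjugates G P. P \<subseteq> normalizer G B} = {P}"
  proof (intro equalityI subsetI; clarify)
    fix B assume B: "B \<in> conjugates G P" "P \<subseteq> normalizer G B"
    have sB: "sylow_subgroup G p B" using sylow_subgroup_conjugates[OF B(1) P] .
    have "P \<subseteq> B" using prime_power_subgroup_normalizing_sylow[OF p P' sB B(2)] .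
    moreover have "card B = card P" using sB P by (simp add: sylow_subgroup_def)
    moreover have "finite B" using finite_subset_carrier conjugates_subset[OF PG B(1)] by blast
    ultimately show "B = P" by (metis card_subset_eq)
  next
    show "P \<in> conjugates G P \<and> P \<subseteq> normalizer G P"
      using self_in_conjugates[OF PG] subgroup_subset_normalizer[OF P'(1)] by blast
  qed
  then show ?thesis
    using conjugates_fixed_points[OF p P' PG] p by (auto dest: prime_gt_1_nat)
qed

text \<open>Under conjugation of \<open>P\<close> on itself the fixed points form the center, whose
  order is therefore 0 modulo \<open>p\<close>. It contains \<open>\<one>\<close>, hence something
  else as well.\<close>

theorem prime_power_center_nontrivial:
  assumes p: "Factorial_Ring.prime (p::nat)" and P: "subgroup P G" "card P = p ^ k" "P \<noteq> {\<one>}"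
  shows "\<exists>z \<in> P. z \<noteq> \<one> \<and> z \<in> centralizer G P"
proof -
  interpret P: group "G\<lparr>carrier := P\<rparr>" using subgroup_imp_group[OF P(1)] .
  interpret sP: subgroup P G using P(1) .
  interpret act: group_action "G\<lparr>carrier := P\<rparr>" P "\<lambda>g. \<lambda>h\<in>P. g \<otimes> h \<otimes> inv g"
  proof (rule P.group_action_restrictI)
    fix g h x assume "g \<in> carrier (G\<lparr>carrier := P\<rparr>)" "h \<in> carrier (G\<lparr>carrier := P\<rparr>)" "x \<in> P"
    then show "g \<otimes>\<^bsub>G\<lparr>carrier := P\<rparr>\<^esub> h \<otimes> x \<otimes> inv (g \<otimes>\<^bsub>G\<lparr>carrier := P\<rparr>\<^esub> h)
        = g \<otimes> (h \<otimes> x \<otimes> inv h) \<otimes> inv g"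
      using conj_mult[of g h x] sP.subset by auto
  qed simp_all
  let ?F = "{x \<in> P. \<forall>g\<in>carrier (G\<lparr>carrier := P\<rparr>). (\<lambda>h\<in>P. g \<otimes> h \<otimes> inv g) x = x}"
  have F: "?F = P \<inter> centralizer G P"
  proof -
    have "g \<otimes> x \<otimes> inv g = x \<longleftrightarrow> x \<otimes> g = g \<otimes> x" if "x \<in> P" "g \<in> P" for x g
      using inv_solve_right[of x "g \<otimes> x" g] that sP.mem_carrier m_closed by metis
    then show ?thesis by (auto simp: centralizer_def)
  qed
  have "k \<noteq> 0" using P subgroup_eq_one_if_card_one[OF P(1)] by (cases k) auto
  then have "card P mod p = 0" using P(2) by simp
  then have dvd: "p dvd card (P \<inter> centralizer G P)"
    using act.prime_power_fixed_points[OF p, of k] P(2) finite_subset_carrier[OF sP.subset]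
    unfolding F by (simp add: order_def dvd_eq_mod_eq_0)
  have "\<one> \<in> P \<inter> centralizer G P" by (auto simp: centralizer_def)
  moreover have "P \<inter> centralizer G P \<noteq> {\<one>}"
  proof
    assume "P \<inter> centralizer G P = {\<one>}"
    then have "p dvd 1" using dvd by simp
    then show False using p by simp
  qed
  ultimately show ?thesis by blast
qed

end

text \<open>The orders of the image of \<open>P\<close> and of its intersection with the kernel are
  powers of \<open>p\<close> whose product is the full p-part of \<open>|G| = |H| * |K|\<close>.
  Neither exponent can exceed the multiplicity in its own factor, so both attain it.\<close>

lemma sylow_subgroup_image_and_kernel:
  assumes G: "finite_group G" and H: "finite_group H" and h: "group_hom G H h"
    and surj: "h ` carrier G = carrier H"
    and p: "Factorial_Ring.prime (p::nat)" and P: "sylow_subgroup G p P"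
  shows "sylow_subgroup H p (h ` P)"
    and "card (P \<inter> kernel G H h) = p ^ multiplicity p (card (kernel G H h))"
proof -
  interpret G: finite_group G by fact
  interpret H: finite_group H by fact
  interpret group_hom G H h by fact
  have P': "subgroup P G" "card P = p ^ multiplicity p (order G)"
    using P by (auto simp: sylow_subgroup_def)
  let ?K = "kernel G H h"
  have cP: "card (h ` P) * card (P \<inter> ?K) = card P"
    using card_image_mult_card_kernel[OF P'(1)] .
  have cG: "order H * card ?K = order G"
    using card_image_mult_card_kernel[OF G.subgroup_self] surj
    by (simp add: order_def kernel_def Int_absorb1 Int_def conj_commute cong: conj_cong)
  have pos: "order H > 0" "card ?K > 0" using H.order_pos G.order_pos cG by (auto intro: Nat.gr0I)
  have pe: "Factorial_Ring.prime_elem p" "\<not> is_unit p" using p by auto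
  have mult: "multiplicity p (order G) = multiplicity p (order H) + multiplicity p (card ?K)"
    using prime_elem_multiplicity_mult_distrib[OF pe(1), of "order H" "card ?K"] pos cG by simp
  obtain i where i: "card (h ` P) = p ^ i"
    using cP P'(2) divides_primepow_nat[OF p] by (metis dvd_triv_left)
  obtain j where j: "card (P \<inter> ?K) = p ^ j"
    using cP P'(2) divides_primepow_nat[OF p] by (metis dvd_triv_right)
  have "p ^ (i + j) = p ^ multiplicity p (order G)" using cP i j P'(2) by (simp add: power_add)
  then have ij: "i + j = multiplicity p (order G)" using p prime_gt_1_nat power_inject_exp by blast
  have "p ^ i dvd order H" using i H.card_subgroup_dvd[OF subgroup_img_is_subgroup[OF P'(1)]] by simp
  then have ile: "i \<le> multiplicity p (order H)" using pos pe by (intro multiplicity_geI) auto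
  have "p ^ j dvd card ?K"
    using j G.card_subgroup_dvd_card_subgroup[of "P \<inter> ?K" ?K]
      G.subgroups_Inter_pair[OF P'(1) subgroup_kernel] subgroup_kernel by simp
  then have jle: "j \<le> multiplicity p (card ?K)" using pos pe by (intro multiplicity_geI) auto
  have eq: "i = multiplicity p (order H)" "j = multiplicity p (card ?K)"
    using ij ile jle mult by linarith+
  show "sylow_subgroup H p (h ` P)"
    unfolding sylow_subgroup_def using i eq(1) subgroup_img_is_subgroup[OF P'(1)] by blast
  show "card (P \<inter> ?K) = p ^ multiplicity p (card ?K)"
    using j eq(2) by blast
qed

section \<open>Sylow subgroups that almost commute\<close>

text \<open>The index of \<open>C\<^sub>P(Q)\<close> in \<open>P\<close> divides
  \<open>k p q\<close>, written without division. A value \<open>k p q = 0\<close> imposes no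
  condition, and the value 1 says that \<open>P\<close> and \<open>Q\<close> commute elementwise. As
  in \<open>pr_star\<close>, the pair of Sylow subgroups may depend on the primes.\<close>

definition sylows_commute_up_to :: "(nat \<Rightarrow> nat \<Rightarrow> nat) \<Rightarrow> ('a, 'b) monoid_scheme \<Rightarrow> bool" where
  "sylows_commute_up_to k G \<longleftrightarrow>
    (\<forall>p q. Factorial_Ring.prime p \<longrightarrow> Factorial_Ring.prime q \<longrightarrow> p \<noteq> q \<longrightarrow>
      (\<exists>P Q. sylow_subgroup G p P \<and> sylow_subgroup G q Q \<and>
        card P dvd k p q * card (P \<inter> centralizer G Q)))"

section \<open>Passing the bounds to quotients and normal subgroups\<close>

lemma (in normal) kernel_r_coset: "kernel G (G Mod H) (\<lambda>a. H #> a) = H"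
  using coset_join1[OF _ _ is_subgroup] coset_join2[OF _ is_subgroup] subset
  by (auto simp: kernel_def FactGroup_def)

lemma (in normal) r_coset_group_hom: "group_hom G (G Mod H) (\<lambda>a. H #> a)"
  by (intro group_hom.intro group_hom_axioms.intro is_group factorgroup_is_group r_coset_hom_Mod)

lemma (in normal) r_coset_surj: "(\<lambda>a. H #> a) ` carrier G = carrier (G Mod H)"
  by (auto simp: FactGroup_def RCOSETS_def)

lemma (in normal) finite_group_Mod: "finite (carrier G) \<Longrightarrow> finite_group (G Mod H)"
  unfolding finite_group_def finite_group_axioms_def r_coset_surj[symmetric]
  using factorgroup_is_group by simp

lemma (in finite_group) finite_group_subgroup:
  assumes "subgroup N G"
  shows "finite_group (G\<lparr>carrier := N\<rparr>)"
  using subgroup_imp_group[OF assms] finite_subset_carrier[OF subgroup.subset[OF assms]]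
  by (simp add: finite_group_def finite_group_axioms_def)

text \<open>The common core of both transfers: \<open>D\<close> is the part of \<open>P\<close>
  centralizing a Sylow subgroup, while \<open>A\<close> and \<open>B\<close> are the images of
  \<open>P\<close> and \<open>D\<close> or their intersections with a normal subgroup. All orders
  are powers of \<open>p\<close>, so an index \<open>|A| / |B|\<close> not exceeding
  \<open>|P| / |D|\<close> inherits its divisibility.\<close>

lemma (in finite_group) prime_power_subset_dvd:
  assumes p: "Factorial_Ring.prime (p::nat)" and P: "subgroup P G" "card P = p ^ c"
    and D: "subgroup D G" "D \<subseteq> P" "card P dvd k * card D"
    and A: "card A dvd card P" and B: "card B dvd card D"
    and le: "card A * card D \<le> card P * card B"
  shows "card A dvd k * card B"
proof -
  have "card D dvd p ^ c" using card_subgroup_dvd_card_subgroup[OF D(1) P(1) D(2)] P(2) by simp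
  then obtain d where d: "d \<le> c" "card D = p ^ d" using divides_primepow_nat[OF p] by blast
  obtain a where a: "card A = p ^ a" using A P(2) divides_primepow_nat[OF p] by auto
  obtain b where b: "card B = p ^ b" using B d(2) divides_primepow_nat[OF p] by auto
  show ?thesis
    using prime_power_mult_le_imp_dvd[OF p, of c k d a b] D(3) le P(2) d a b by simp
qed

text \<open>Images of Sylow subgroups are Sylow, and the image of \<open>C\<^sub>P(Q)\<close>
  centralizes the image of \<open>Q\<close>. Its index does not grow, because the kernel meets
  \<open>C\<^sub>P(Q)\<close> in no more elements than it meets \<open>P\<close>.\<close>

lemma sylows_commute_up_to_image:
  assumes G: "finite_group G" and H: "finite_group H" and h: "group_hom G H h"
    and surj: "h ` carrier G = carrier H" and k: "sylows_commute_up_to k G"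
  shows "sylows_commute_up_to k H"
  unfolding sylows_commute_up_to_def
proof (intro allI impI)
  fix p q :: nat
  assume p: "Factorial_Ring.prime p" and q: "Factorial_Ring.prime q" and "p \<noteq> q"
  interpret G: finite_group G by fact
  interpret H: finite_group H by fact
  interpret group_hom G H h by fact
  obtain P Q where P: "sylow_subgroup G p P" and Q: "sylow_subgroup G q Q"
    and dvd: "card P dvd k p q * card (P \<inter> centralizer G Q)"
    using k p q \<open>p \<noteq> q\<close> unfolding sylows_commute_up_to_def by blast
  let ?D = "P \<inter> centralizer G Q" and ?K = "kernel G H h"
  have sP: "subgroup P G" and sQ: "subgroup Q G" and cardP: "card P = p ^ multiplicity p (order G)"
    using P Q by (auto simp: sylow_subgroup_def)
  have sub: "P \<subseteq> carrier G" "Q \<subseteq> carrier G" using sP sQ subgroup.subset by blast+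
  have sD: "subgroup ?D G"
    using G.subgroups_Inter_pair[OF sP G.subgroup_centralizer[OF sub(2)]] .
  have hP: "sylow_subgroup H p (h ` P)" and hQ: "sylow_subgroup H q (h ` Q)"
    using sylow_subgroup_image_and_kernel(1)[OF G H h surj] p q P Q by blast+
  have cP: "card (h ` P) * card (P \<inter> ?K) = card P" and cD: "card (h ` ?D) * card (?D \<inter> ?K) = card ?D"
    using card_image_mult_card_kernel sP sD by blast+
  have "card (?D \<inter> ?K) \<le> card (P \<inter> ?K)"
    using G.finite_subset_carrier sub by (intro card_mono) auto
  then have "card (h ` P) * card ?D \<le> card P * card (h ` ?D)"
    by (rule mult_cross_mono[OF cP cD])
  moreover have "card (h ` P) dvd card P" "card (h ` ?D) dvd card ?D"
    unfolding cP[symmetric] cD[symmetric] by (rule dvd_triv_left)+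
  ultimately have 1: "card (h ` P) dvd k p q * card (h ` ?D)"
    by (intro G.prime_power_subset_dvd[OF p sP cardP sD Int_lower1 dvd])
  have "h ` ?D \<subseteq> h ` P \<inter> centralizer H (h ` Q)"
  proof
    fix y assume "y \<in> h ` ?D"
    then obtain x where x: "x \<in> P" "x \<in> centralizer G Q" "y = h x" by auto
    have "h x \<otimes>\<^bsub>H\<^esub> h z = h z \<otimes>\<^bsub>H\<^esub> h x" if "z \<in> Q" for z
      using that x sub by (auto simp: centralizer_def subset_iff simp flip: hom_mult)
    then show "y \<in> h ` P \<inter> centralizer H (h ` Q)"
      using x sub by (auto simp: centralizer_def)
  qed
  then have "card (h ` ?D) dvd card (h ` P \<inter> centralizer H (h ` Q))"
    using sub(2)
    by (intro H.card_subgroup_dvd_card_subgroup[OF subgroup_img_is_subgroup[OF sD]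
          H.subgroups_Inter_pair[OF subgroup_img_is_subgroup[OF sP] H.subgroup_centralizer]]) auto
  with 1 have "card (h ` P) dvd k p q * card (h ` P \<inter> centralizer H (h ` Q))"
    by (meson dvd_refl dvd_trans mult_dvd_mono)
  then show "\<exists>P Q. sylow_subgroup H p P \<and> sylow_subgroup H q Q \<and>
        card P dvd k p q * card (P \<inter> centralizer H Q)"
    using hP hQ by blast
qed

text \<open>Intersections with \<open>N\<close> of Sylow subgroups are Sylow in \<open>N\<close>.
  The index of \<open>C\<^sub>P(Q) \<inter> N\<close> in \<open>P \<inter> N\<close> does not exceed
  the original one, because modulo \<open>N\<close> the image of \<open>C\<^sub>P(Q)\<close> is no
  larger than that of \<open>P\<close>.\<close>

lemma sylows_commute_up_to_normal:
  assumes G: "finite_group G" and N: "N \<lhd> G" and k: "sylows_commute_up_to k G"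
  shows "sylows_commute_up_to k (G\<lparr>carrier := N\<rparr>)"
  unfolding sylows_commute_up_to_def
proof (intro allI impI)
  fix p q :: nat
  assume p: "Factorial_Ring.prime p" and q: "Factorial_Ring.prime q" and "p \<noteq> q"
  interpret G: finite_group G by fact
  interpret N: normal N G by fact
  let ?h = "\<lambda>a. N #>\<^bsub>G\<^esub> a"
  interpret h: group_hom G "G Mod N" ?h by (rule N.r_coset_group_hom)
  have H: "finite_group (G Mod N)" using N.finite_group_Mod G.finite_carrier .
  interpret H: finite_group "G Mod N" by fact
  interpret GN: finite_group "G\<lparr>carrier := N\<rparr>" using G.finite_group_subgroup[OF N.is_subgroup] .
  note ker = N.kernel_r_coset
  obtain P Q where P: "sylow_subgroup G p P" and Q: "sylow_subgroup G q Q"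
    and dvd: "card P dvd k p q * card (P \<inter> centralizer G Q)"
    using k p q \<open>p \<noteq> q\<close> unfolding sylows_commute_up_to_def by blast
  let ?D = "P \<inter> centralizer G Q"
  have sP: "subgroup P G" and sQ: "subgroup Q G" and cardP: "card P = p ^ multiplicity p (order G)"
    using P Q by (auto simp: sylow_subgroup_def)
  have sub: "P \<subseteq> carrier G" "Q \<subseteq> carrier G" using sP sQ subgroup.subset by blast+
  have sD: "subgroup ?D G"
    using G.subgroups_Inter_pair[OF sP G.subgroup_centralizer[OF sub(2)]] .
  have inN: "subgroup (A \<inter> N) (G\<lparr>carrier := N\<rparr>)" if "subgroup A G" for A
    using G.subgroup_incl[OF G.subgroups_Inter_pair[OF that N.is_subgroup] N.is_subgroup] by simp
  have syl: "sylow_subgroup (G\<lparr>carrier := N\<rparr>) r (R \<inter> N)"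
    if "Factorial_Ring.prime r" "sylow_subgroup G r R" for r R
    using sylow_subgroup_image_and_kernel(2)[OF G H h.group_hom_axioms N.r_coset_surj that] inN[of R] that(2)
    unfolding ker by (simp add: sylow_subgroup_def order_def)
  have cP: "card (?h ` P) * card (P \<inter> N) = card P" and cD: "card (?h ` ?D) * card (?D \<inter> N) = card ?D"
    using h.card_image_mult_card_kernel sP sD unfolding ker by blast+
  have "card (?h ` ?D) \<le> card (?h ` P)"
    using G.finite_subset_carrier sub by (intro card_mono) auto
  then have "card (P \<inter> N) * card ?D \<le> card P * card (?D \<inter> N)"
    by (intro mult_cross_mono[OF cP[unfolded mult.commute[of "card (?h ` P)"]]
          cD[unfolded mult.commute[of "card (?h ` ?D)"]]])
  moreover have "card (P \<inter> N) dvd card P" "card (?D \<inter> N) dvd card ?D"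
    unfolding cP[symmetric] cD[symmetric] by (rule dvd_triv_right)+
  ultimately have 1: "card (P \<inter> N) dvd k p q * card (?D \<inter> N)"
    by (intro G.prime_power_subset_dvd[OF p sP cardP sD Int_lower1 dvd])
  have "?D \<inter> N \<subseteq> (P \<inter> N) \<inter> centralizer (G\<lparr>carrier := N\<rparr>) (Q \<inter> N)"
    by (auto simp: centralizer_def)
  then have "card (?D \<inter> N) dvd card ((P \<inter> N) \<inter> centralizer (G\<lparr>carrier := N\<rparr>) (Q \<inter> N))"
    by (intro GN.card_subgroup_dvd_card_subgroup[OF inN[OF sD]
          GN.subgroups_Inter_pair[OF inN[OF sP] GN.subgroup_centralizer]]) auto
  with 1 have "card (P \<inter> N) dvd k p q * card ((P \<inter> N) \<inter> centralizer (G\<lparr>carrier := N\<rparr>) (Q \<inter> N))"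
    by (meson dvd_refl dvd_trans mult_dvd_mono)
  then show "\<exists>P Q. sylow_subgroup (G\<lparr>carrier := N\<rparr>) p P \<and> sylow_subgroup (G\<lparr>carrier := N\<rparr>) q Q \<and>
        card P dvd k p q * card (P \<inter> centralizer (G\<lparr>carrier := N\<rparr>) Q)"
    using syl[OF p P] syl[OF q Q] by blast
qed

text \<open>The hypothesis concerns some Sylow q-subgroup \<open>Q'\<close>. The prescribed
  \<open>Q\<close> is conjugate to it, so their centralizers have the same order, and the order is
  all that the later counting uses.\<close>

lemma (in finite_group) prime_power_dvd_centralizer_sylow:
  assumes k: "sylows_commute_up_to k G" and p: "Factorial_Ring.prime p" and q: "Factorial_Ring.prime q"
    and "p \<noteq> q" and Q: "sylow_subgroup G q Q"
  shows "p ^ multiplicity p (order G) dvd k p q * card (centralizer G Q)"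
proof -
  obtain P Q' where P: "sylow_subgroup G p P" and Q': "sylow_subgroup G q Q'"
    and dvd: "card P dvd k p q * card (P \<inter> centralizer G Q')"
    using k p q \<open>p \<noteq> q\<close> unfolding sylows_commute_up_to_def by blast
  have sP: "subgroup P G" and sub: "Q' \<subseteq> carrier G"
    using P Q' by (auto simp: sylow_subgroup_def subgroup.subset)
  obtain g where g: "g \<in> carrier G" "Q = conj_set G g Q'"
    using sylow_subgroups_conjugate[OF q Q Q'] by (auto simp: conjugates_def)
  have C: "subgroup (centralizer G Q') G" using subgroup_centralizer[OF sub] .
  have "card (centralizer G Q) = card (centralizer G Q')"
    using g sub C by (simp add: centralizer_conj_set card_conj_set subgroup.subset)
  moreover have "card (P \<inter> centralizer G Q') dvd card (centralizer G Q')"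
    by (intro card_subgroup_dvd_card_subgroup subgroups_Inter_pair sP C) simp
  ultimately have "k p q * card (P \<inter> centralizer G Q') dvd k p q * card (centralizer G Q)"
    by (intro mult_dvd_mono) simp_all
  with dvd have "card P dvd k p q * card (centralizer G Q)" by (rule dvd_trans)
  then show ?thesis using P by (simp add: sylow_subgroup_def)
qed

section \<open>Nilpotency\<close>

text \<open>For a central element \<open>z\<close> of \<open>P\<close>, the order of its centralizer
  is checked prime by prime: the p-part comes from \<open>P\<close>, and every other part from
  \<open>centralizer G P\<close>, which is contained in the centralizer of \<open>z\<close>.\<close>

lemma (in finite_group) center_nontrivial_if_sylows_commute:
  assumes k: "sylows_commute_up_to (\<lambda>_ _. 1) G" and "order G > 1"
  shows "\<exists>z. z \<noteq> \<one> \<and> z \<in> centralizer G (carrier G)"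
proof -
  obtain p where p: "Factorial_Ring.prime p" "p dvd order G"
    using \<open>order G > 1\<close> prime_factor_nat by (metis less_irrefl)
  obtain P where P: "sylow_subgroup G p P" using sylow_subgroup_exists[OF p(1)] by blast
  have sP: "subgroup P G" and cP: "card P = p ^ multiplicity p (order G)"
    using P by (auto simp: sylow_subgroup_def)
  have "multiplicity p (order G) > 0" using p order_pos by (simp add: prime_multiplicity_gt_zero_iff)
  then have "card P \<noteq> 1" using cP p by (auto simp: prime_nat_iff)
  then have "P \<noteq> {\<one>}" by auto
  then obtain z where z: "z \<in> P" "z \<noteq> \<one>" "z \<in> centralizer G P"
    using prime_power_center_nontrivial[OF p(1) sP cP] by auto
  have zG: "z \<in> carrier G" using subgroup.mem_carrier[OF sP z(1)] .
  have C: "subgroup (centralizer G {z}) G" using subgroup_centralizer[of "{z}"] zG by simp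
  have "order G dvd card (centralizer G {z})"
  proof (rule dvd_if_prime_powers_dvd[OF order_pos])
    fix q :: nat assume q: "Factorial_Ring.prime q"
    show "q ^ multiplicity q (order G) dvd card (centralizer G {z})"
    proof (cases "q = p")
      case True
      have "P \<subseteq> centralizer G {z}" using z sP by (auto simp: centralizer_def subgroup.mem_carrier)
      then show ?thesis using card_subgroup_dvd_card_subgroup[OF sP C] cP True by simp
    next
      case False
      have "centralizer G P \<subseteq> centralizer G {z}" using z by (auto simp: centralizer_def)
      then have "card (centralizer G P) dvd card (centralizer G {z})"
        using card_subgroup_dvd_card_subgroup[OF subgroup_centralizer C] subgroup.subset[OF sP] by simp
      then show ?thesis
        using prime_power_dvd_centralizer_sylow[OF k q p(1) False P] dvd_trans by simp
    qed
  qed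
  then have "centralizer G {z} = carrier G" using card_subgroup_eq_order[OF C] by blast
  then have "g \<in> centralizer G {z}" if "g \<in> carrier G" for g
    using that by simp
  then have "z \<otimes> g = g \<otimes> z" if "g \<in> carrier G" for g
    using that by (simp add: centralizer_def)
  then show ?thesis using z zG by (auto simp: centralizer_def)
qed

theorem (in finite_group) nilpotent_if_sylows_commute:
  assumes k: "sylows_commute_up_to (\<lambda>_ _. 1) G"
  shows "nilpotent_group G"
proof -
  \<comment> \<open>The upper central series in disguise: induction from large \<open>Z\<close> to
    small. Replace \<open>Z\<close> by the preimage \<open>U\<close> of the center of
    \<open>G Mod Z\<close>. A term of the lower central series inside \<open>U\<close> has its
    successor inside \<open>Z\<close>. In the end \<open>Z\<close> is trivial.\<close>
  have step: "\<exists>n. lower_central_series G n \<subseteq> Z" if "Z \<lhd> G" for Z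
    using that
  proof (induction "order G - card Z" arbitrary: Z rule: less_induct)
    case less
    interpret Z: normal Z G by (rule less.prems)
    show ?case
    proof (cases "Z = carrier G")
      case True
      then show ?thesis by (intro exI[of _ 0]) simp
    next
      case False
      interpret Q: finite_group "G Mod Z" using Z.finite_group_Mod[OF finite_carrier] .
      have ord: "order (G Mod Z) * card Z = order G"
        using lagrange[OF Z.is_subgroup] by (simp add: order_def FactGroup_def)
      have "order (G Mod Z) \<noteq> 1"
        using ord False card_subgroup_eq_order[OF Z.is_subgroup] by auto
      then have "order (G Mod Z) > 1" using Q.order_pos by linarith
      moreover have "sylows_commute_up_to (\<lambda>_ _. 1) (G Mod Z)"
        by (rule sylows_commute_up_to_image[OF finite_group_axioms Q.finite_group_axioms
              Z.r_coset_group_hom Z.r_coset_surj k])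
      ultimately obtain c where c: "c \<noteq> \<one>\<^bsub>G Mod Z\<^esub>" "c \<in> centralizer (G Mod Z) (carrier (G Mod Z))"
        using Q.center_nontrivial_if_sylows_commute by blast
      let ?C = "centralizer (G Mod Z) (carrier (G Mod Z))"
      have sC: "subgroup ?C (G Mod Z)" using Q.subgroup_centralizer by blast
      have "?C \<lhd> G Mod Z"
        unfolding Q.normal_inv_iff
      proof (intro conjI sC ballI)
        fix x h assume x: "x \<in> carrier (G Mod Z)" and h: "h \<in> ?C"
        then have "x \<otimes>\<^bsub>G Mod Z\<^esub> h \<otimes>\<^bsub>G Mod Z\<^esub> inv\<^bsub>G Mod Z\<^esub> x = h \<otimes>\<^bsub>G Mod Z\<^esub> x \<otimes>\<^bsub>G Mod Z\<^esub> inv\<^bsub>G Mod Z\<^esub> x"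
          unfolding centralizer_def by (metis (mono_tags, lifting) mem_Collect_eq)
        also have "\<dots> = h"
          using x h subgroup.mem_carrier[OF sC h] Q.inv_closed[OF x] by (metis Q.m_assoc Q.r_inv Q.r_one)
        finally show "x \<otimes>\<^bsub>G Mod Z\<^esub> h \<otimes>\<^bsub>G Mod Z\<^esub> inv\<^bsub>G Mod Z\<^esub> x \<in> ?C" using h by simp
      qed
      \<comment> \<open>Elements of the quotient are cosets, so the union of a subgroup of the
        quotient is its preimage in \<open>G\<close>.\<close>
      then have nU: "\<Union>?C \<lhd> G" by (rule Z.factgroup_subgroup_union_normal)
      have U: "\<Union>?C = {x \<in> carrier G. Z #> x \<in> ?C}" by (rule Z.factgroup_subgroup_union_char[OF sC])
      have one: "\<one>\<^bsub>G Mod Z\<^esub> = Z" by (simp add: FactGroup_def)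
      have ZU: "Z \<subset> \<Union>?C"
      proof
        show "Z \<subseteq> \<Union>?C" using subgroup.one_closed[OF sC] one by auto
        have "c \<in> (\<lambda>a. Z #> a) ` carrier G"
          using subgroup.mem_carrier[OF sC c(2)] unfolding Z.r_coset_surj[symmetric] .
        then obtain x where x: "x \<in> carrier G" "c = Z #> x" by auto
        then have "x \<notin> Z" using c(1) one coset_join2[OF _ Z.is_subgroup] by auto
        then show "Z \<noteq> \<Union>?C" using x c(2) unfolding U by auto
      qed
      have fU: "finite (\<Union>?C)" using finite_subset_carrier unfolding U by auto
      have "card Z < card (\<Union>?C)" using psubset_card_mono[OF fU ZU] .
      moreover have "card (\<Union>?C) \<le> order G"
        unfolding order_def using finite_carrier by (intro card_mono) (auto simp: U)
      ultimately have "order G - card (\<Union>?C) < order G - card Z" by linarith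
      then obtain n where n: "lower_central_series G n \<subseteq> \<Union>?C" using less.hyps nU by blast
      have "lower_central_series G (Suc n) \<subseteq> Z"
        unfolding lower_central_series.simps commutator_subgroup_def
      proof (rule generate_subgroup_incl[OF _ Z.is_subgroup], clarify)
        fix x y assume "x \<in> lower_central_series G n" and y: "y \<in> carrier G"
        then have x: "x \<in> carrier G" "Z #> x \<in> ?C" using n unfolding U by auto
        have "Z #> y \<in> carrier (G Mod Z)" using y Z.r_coset_surj by blast
        then have "(Z #> x) <#> (Z #> y) = (Z #> y) <#> (Z #> x)"
          using x(2) by (simp add: centralizer_def)
        then have "Z #> (x \<otimes> y) = Z #> (y \<otimes> x)" using x y by (simp add: Z.rcos_sum)
        then have "x \<otimes> y \<in> Z #> (y \<otimes> x)"
          using rcos_self[of "x \<otimes> y", OF _ Z.is_subgroup] x y by simp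
        then have "x \<otimes> y \<otimes> inv (y \<otimes> x) \<in> Z" using x y by (intro Z.rcos_module_imp[OF is_group]) auto
        then show "x \<otimes> y \<otimes> inv x \<otimes> inv y \<in> Z" using x y by (simp add: inv_mult_group m_assoc)
      qed
      then show ?thesis by blast
    qed
  qed
  obtain n where "lower_central_series G n \<subseteq> {\<one>}" using step[OF one_is_normal] by blast
  moreover have "\<one> \<in> lower_central_series G n"
    by (cases n) (auto simp: commutator_subgroup_def generate.one)
  ultimately have "lower_central_series G n = {\<one>}" by blast
  then show ?thesis unfolding nilpotent_group_def using is_group by blast
qed

section \<open>Finite simple groups with almost commuting Sylow subgroups\<close>

text \<open>Members of \<open>Bij S\<close> are undefined outside \<open>S\<close>, permutations are
  the identity there. Changing the values outside \<open>S\<close> matches the two.\<close>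

lemma card_Bij:
  assumes "finite S"
  shows "card (Bij S) = fact (card S)"
proof -
  have "bij_betw (\<lambda>f. restrict f S) {f. f permutes S} (Bij S)"
  proof (rule bij_betw_byWitness[where f' = "\<lambda>f x. if x \<in> S then f x else x"])
    show "\<forall>f\<in>{f. f permutes S}. (\<lambda>x. if x \<in> S then restrict f S x else x) = f"
      by (auto simp: permutes_def)
    show "\<forall>f\<in>Bij S. restrict (\<lambda>x. if x \<in> S then f x else x) S = f"
    proof
      fix f assume "f \<in> Bij S"
      then have "f \<in> extensional S" by (simp add: Bij_def)
      then show "restrict (\<lambda>x. if x \<in> S then f x else x) S = f"
        by (intro extensionalityI[of _ S]) auto
    qed
    show "(\<lambda>f. restrict f S) ` {f. f permutes S} \<subseteq> Bij S"
      using permutes_imp_bij by (auto simp: Bij_def cong: bij_betw_cong)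
    show "(\<lambda>f x. if x \<in> S then f x else x) ` Bij S \<subseteq> {f. f permutes S}"
    proof
      fix f' assume "f' \<in> (\<lambda>f x. if x \<in> S then f x else x) ` Bij S"
      then obtain f where f: "f \<in> Bij S" "f' = (\<lambda>x. if x \<in> S then f x else x)" by blast
      then have "bij_betw f' S S" by (simp add: Bij_def cong: bij_betw_cong)
      then show "f' \<in> {f. f permutes S}" using f by (auto intro!: bij_imp_permutes)
    qed
  qed
  then show ?thesis using card_permutations[OF refl assms] bij_betw_same_card by fastforce
qed

section \<open>Orders of finite simple groups\<close>

locale finite_simple_group = finite_group + simple_group
begin

text \<open>Conjugation on a class with more than one member has a proper kernel, trivial by
  simplicity. So \<open>G\<close> embeds into the symmetric group on the class.\<close>

lemma order_dvd_fact_card_conjugates: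
  assumes A: "A \<subseteq> carrier G" and "card (conjugates G A) \<noteq> 1"
  shows "order G dvd fact (card (conjugates G A))"
proof -
  let ?C = "conjugates G A"
  let ?\<phi> = "\<lambda>g. \<lambda>B\<in>?C. conj_set G g B"
  interpret act: group_action G ?C ?\<phi>
    using conj_set_in_conjugates[OF A] conjugates_subset[OF A] conj_set_mult
    by (intro group_action_restrictI) auto
  interpret hom: group_hom G "BijGroup ?C" ?\<phi> by (rule act.group_hom)
  have "kernel G (BijGroup ?C) ?\<phi> \<noteq> carrier G"
  proof
    assume eq: "kernel G (BijGroup ?C) ?\<phi> = carrier G"
    have "conj_set G g A = A" if "g \<in> carrier G" for g
    proof -
      have "g \<in> kernel G (BijGroup ?C) ?\<phi>" using that eq by simp
      then have "?\<phi> g = (\<lambda>B\<in>?C. B)" by (simp add: kernel_def BijGroup_def)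
      then have "?\<phi> g A = (\<lambda>B\<in>?C. B) A" by (rule fun_cong)
      then show ?thesis using self_in_conjugates[OF A] by simp
    qed
    then have "?C = {A}" using one_closed by (auto simp: conjugates_def)
    then show False using assms(2) by simp
  qed
  then have ker: "kernel G (BijGroup ?C) ?\<phi> = {\<one>}"
    using no_real_normal_subgroup[OF hom.normal_kernel] by blast
  have "card (?\<phi> ` carrier G) = order G"
    using hom.card_image_mult_card_kernel[OF subgroup_self] unfolding ker by (simp add: order_def)
  moreover have "card (?\<phi> ` carrier G) dvd order (BijGroup ?C)"
    using hom.H.lagrange[OF hom.subgroup_img_is_subgroup[OF subgroup_self]] by (metis dvd_triv_right)
  moreover have "order (BijGroup ?C) = fact (card ?C)"
    using card_Bij[OF finite_conjugates] by (simp add: order_def BijGroup_def)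
  ultimately show ?thesis by simp
qed

text \<open>A Sylow subgroup without further conjugates is normal, and it is nontrivial because
  \<open>p\<close> divides the order, so it is the whole group.\<close>

lemma order_prime_power_if_sylow_normal:
  assumes p: "Factorial_Ring.prime (p::nat)" and dvd: "p dvd order G"
    and P: "sylow_subgroup G p P" and one: "card (conjugates G P) = 1"
  shows "order G = p ^ multiplicity p (order G)"
proof -
  have sP: "subgroup P G" and cP: "card P = p ^ multiplicity p (order G)"
    using P by (auto simp: sylow_subgroup_def)
  have PG: "P \<subseteq> carrier G" using subgroup.subset[OF sP] .
  have "card (normalizer G P) = order G" using card_conjugates[OF PG] one by simp
  then have "normalizer G P = carrier G"
    using card_subgroup_eq_order[OF subgroup_normalizer[OF PG]] by simp
  then have "P \<lhd> G" using normal_iff_normalizer[OF sP] by blast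
  then have "P = carrier G \<or> P = {\<one>}" using no_real_normal_subgroup by blast
  moreover have "multiplicity p (order G) > 0"
    using p dvd order_pos by (simp add: prime_multiplicity_gt_zero_iff)
  then have "card P \<noteq> 1" using cP p by (auto simp: prime_nat_iff)
  then have "P \<noteq> {\<one>}" by auto
  ultimately show ?thesis using cP by (simp add: order_def)
qed

text \<open>The center is normal and nontrivial, so by simplicity the group is abelian.\<close>

lemma solvable_if_order_prime_power:
  assumes p: "Factorial_Ring.prime (p::nat)" and ord: "order G = p ^ k"
  shows "solvable G"
proof -
  let ?Z = "centralizer G (carrier G)"
  have sZ: "subgroup ?Z G" using subgroup_centralizer by blast
  obtain z where z: "z \<noteq> \<one>" "z \<in> ?Z"
    using prime_power_center_nontrivial[OF p subgroup_self, of k] ord simple_not_triv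
    by (auto simp: order_def)
  have "?Z \<lhd> G"
    unfolding normal_inv_iff
  proof (intro conjI sZ ballI)
    fix x h assume x: "x \<in> carrier G" and h: "h \<in> ?Z"
    then have "h \<otimes> x = x \<otimes> h" by (simp add: centralizer_def)
    then have "x \<otimes> h \<otimes> inv x = h \<otimes> x \<otimes> inv x" by simp
    also have "\<dots> = h" using x subgroup.mem_carrier[OF sZ h] by (simp add: m_assoc)
    finally show "x \<otimes> h \<otimes> inv x \<in> ?Z" using h by simp
  qed
  then have "?Z = carrier G" using no_real_normal_subgroup z by blast
  then have "x \<otimes> y = y \<otimes> x" if "x \<in> carrier G" "y \<in> carrier G" for x y
  proof -
    have "x \<in> ?Z" using that \<open>?Z = carrier G\<close> by simp
    then show ?thesis using that(2) by (simp add: centralizer_def)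
  qed
  then interpret comm_group G by (intro group_comm_groupI)
  have "(derived G ^^ 1) (carrier G) = {\<one>}" using derived_eq_singleton[of "carrier G"] by simp
  then show ?thesis unfolding solvable_iff_trivial_derived_seq by blast
qed

end

section \<open>Counting Sylow subgroups and elements\<close>

context finite_group
begin

text \<open>Prime by prime: the q-part of \<open>|G|\<close> comes from \<open>Q\<close>, and any
  other p-part divides \<open>k p q * |centralizer G Q|\<close>, hence \<open>m * card K\<close>.
  With \<open>K\<close> the normalizer this bounds the number of Sylow q-subgroups; \<open>K\<close>
  can also be the centralizer if that contains \<open>Q\<close>.\<close>

lemma order_dvd_index_bound:
  assumes k: "sylows_commute_up_to k G" and q: "Factorial_Ring.prime (q::nat)"
    and Q: "sylow_subgroup G q Q" and K: "subgroup K G" "Q \<subseteq> K" "centralizer G Q \<subseteq> K"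
    and m: "\<And>p. \<lbrakk>Factorial_Ring.prime p; p \<noteq> q; p dvd order G\<rbrakk> \<Longrightarrow> k p q dvd m"
  shows "order G dvd m * card K"
proof (rule dvd_if_prime_powers_dvd[OF order_pos])
  fix p :: nat assume p: "Factorial_Ring.prime p"
  have sQ: "subgroup Q G" and cQ: "card Q = q ^ multiplicity q (order G)"
    using Q by (auto simp: sylow_subgroup_def)
  consider "p = q" | "\<not> p dvd order G" | "p \<noteq> q" "p dvd order G" by blast
  then show "p ^ multiplicity p (order G) dvd m * card K"
  proof cases
    case 1
    then show ?thesis using card_subgroup_dvd_card_subgroup[OF sQ K(1,2)] cQ by simp
  next
    case 2
    then show ?thesis by (simp add: not_dvd_imp_multiplicity_0)
  next
    case 3
    have "card (centralizer G Q) dvd card K"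
      by (intro card_subgroup_dvd_card_subgroup subgroup_centralizer K subgroup.subset sQ)
    then have "k p q * card (centralizer G Q) dvd m * card K"
      using m[OF p 3] by (intro mult_dvd_mono)
    then show ?thesis
      using prime_power_dvd_centralizer_sylow[OF k p q 3(1) Q] by (rule dvd_trans[rotated])
  qed
qed

lemma card_conjugates_sylow_dvd:
  assumes "sylows_commute_up_to k G" "Factorial_Ring.prime (q::nat)"
    and Q: "sylow_subgroup G q Q"
    and "\<And>p. \<lbrakk>Factorial_Ring.prime p; p \<noteq> q; p dvd order G\<rbrakk> \<Longrightarrow> k p q dvd m"
  shows "card (conjugates G Q) dvd m"
proof -
  have sQ: "subgroup Q G" using Q by (auto simp: sylow_subgroup_def)
  note QG = subgroup.subset[OF sQ]
  have "order G dvd m * card (normalizer G Q)"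
    by (rule order_dvd_index_bound[OF assms(1,2) Q subgroup_normalizer[OF QG]
          subgroup_subset_normalizer[OF sQ] centralizer_subset_normalizer[OF QG] assms(4)])
  then have "card (conjugates G Q) * card (normalizer G Q) dvd m * card (normalizer G Q)"
    using card_conjugates[OF QG] by simp
  then show ?thesis using card_subgroup_pos[OF subgroup_normalizer[OF QG]] by simp
qed

lemma subgroup_of_prime_order:
  assumes "subgroup A G" "subgroup B G" "B \<subseteq> A" "Factorial_Ring.prime (card A)"
  shows "B = A \<or> B = {\<one>}"
proof -
  have "card B dvd card A" using card_subgroup_dvd_card_subgroup[OF assms(2,1,3)] .
  then have "card B = 1 \<or> card B = card A" using assms(4) by (simp add: prime_nat_iff)
  then show ?thesis
    using subgroup_eq_one_if_card_one[OF assms(2)] assms(3)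
      card_subset_eq[OF finite_subset_carrier[OF subgroup.subset[OF assms(1)]]] by blast
qed

text \<open>Distinct subgroups of the same prime order meet only in \<open>\<one>\<close>, so the
  union is disjoint.\<close>

lemma card_Union_conjugates_prime_order:
  assumes A: "subgroup A G" "Factorial_Ring.prime (card A)"
  shows "card (\<Union>B\<in>conjugates G A. B - {\<one>}) = card (conjugates G A) * (card A - 1)"
proof -
  have AG: "A \<subseteq> carrier G" using subgroup.subset[OF A(1)] .
  have B: "subgroup B G" "card B = card A" if "B \<in> conjugates G A" for B
    using that subgroup_conj_set[OF _ A(1)] card_conj_set[OF _ AG] by (auto simp: conjugates_def)
  have "card (\<Union>B\<in>conjugates G A. B - {\<one>}) = (\<Sum>B\<in>conjugates G A. card (B - {\<one>}))"
  proof (rule card_UN_disjoint[OF finite_conjugates], intro ballI)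
    fix B assume "B \<in> conjugates G A"
    then show "finite (B - {\<one>})" using finite_subset_carrier[OF subgroup.subset[OF B(1)]] by simp
  next
    show "\<forall>B\<in>conjugates G A. \<forall>B'\<in>conjugates G A. B \<noteq> B' \<longrightarrow> (B - {\<one>}) \<inter> (B' - {\<one>}) = {}"
    proof (intro ballI impI)
      fix B B' assume *: "B \<in> conjugates G A" "B' \<in> conjugates G A" "B \<noteq> B'"
      have sub: "subgroup (B \<inter> B') G" using subgroups_Inter_pair B * by blast
      have "B \<inter> B' = B \<or> B \<inter> B' = {\<one>}" "B \<inter> B' = B' \<or> B \<inter> B' = {\<one>}"
        using subgroup_of_prime_order[OF B(1)[OF *(1)] sub] subgroup_of_prime_order[OF B(1)[OF *(2)] sub]
          B(2) * A(2) by simp_all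
      then have "B \<inter> B' = {\<one>}" using *(3) by blast
      then show "(B - {\<one>}) \<inter> (B' - {\<one>}) = {}" by blast
    qed
  qed
  also have "\<dots> = (\<Sum>B\<in>conjugates G A. card A - 1)"
    using B subgroup.one_closed[OF B(1)] by (intro sum.cong) (simp_all add: card_Diff_singleton)
  finally show ?thesis by simp
qed

text \<open>The product map on \<open>A \<times> B\<close> is injective: equal products give
  \<open>inv a' \<otimes> a = b' \<otimes> inv b\<close>, an element of both subgroups.\<close>

lemma card_mult_le_order_if_inter_trivial:
  assumes A: "subgroup A G" and B: "subgroup B G" and AB: "A \<inter> B = {\<one>}"
  shows "card A * card B \<le> order G"
proof -
  have "inj_on (\<lambda>(a, b). a \<otimes> b) (A \<times> B)"
  proof (rule inj_onI, clarify)
    fix a b a' b' assume *: "a \<in> A" "b \<in> B" "a' \<in> A" "b' \<in> B" and eq: "a \<otimes> b = a' \<otimes> b'"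
    note A' = subgroup.mem_carrier[OF A] subgroup.m_closed[OF A] subgroup.m_inv_closed[OF A]
    note B' = subgroup.mem_carrier[OF B] subgroup.m_closed[OF B] subgroup.m_inv_closed[OF B]
    note c = A'(1)[OF *(1)] B'(1)[OF *(2)] A'(1)[OF *(3)] B'(1)[OF *(4)]
    have "inv a' \<otimes> a = inv a' \<otimes> (a \<otimes> b) \<otimes> inv b" using c by (simp add: m_assoc)
    also have "\<dots> = b' \<otimes> inv b"
      unfolding eq using c m_assoc[of "inv a'" a' b'] by simp
    finally have e: "inv a' \<otimes> a = b' \<otimes> inv b" .
    moreover have "inv a' \<otimes> a \<in> A" using A'(2)[OF A'(3)[OF *(3)] *(1)] .
    moreover have "b' \<otimes> inv b \<in> B" using B'(2)[OF *(4) B'(3)[OF *(2)]] .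
    ultimately have 1: "inv a' \<otimes> a = \<one>" "b' \<otimes> inv b = \<one>" using AB by auto
    have "a = a'" using inv_solve_left[of \<one> a' a] 1(1) c by simp
    moreover have "b = b'" using inv_solve_right[of \<one> b' b] 1(2) c by simp
    ultimately show "a = a' \<and> b = b'" by blast
  qed
  then have "card (A \<times> B) = card ((\<lambda>(a, b). a \<otimes> b) ` (A \<times> B))" by (simp add: card_image)
  also have "\<dots> \<le> card (carrier G)"
    using finite_carrier subgroup.mem_carrier[OF A] subgroup.mem_carrier[OF B]
    by (intro card_mono) auto
  finally show ?thesis by (simp add: order_def card_cartesian_product)
qed

end

section \<open>Excluding six Sylow 5-subgroups\<close>

context finite_simple_group
begin

text \<open>The faithful action on six conjugates makes \<open>|G|\<close> divide 720, so
  \<open>|Q| = 5\<close>. The centralizers of two distinct conjugates meet trivially, which together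
  with \<open>order G dvd 6 * card ?C\<close> forces \<open>|G| = 30\<close>. Counting elements of
  orders 5 and 3 then gives a contradiction.\<close>

lemma card_conjugates_sylow_5_neq_6:
  assumes k: "sylows_commute_up_to k G" and Q: "sylow_subgroup G 5 Q"
    and m: "\<And>p. \<lbrakk>Factorial_Ring.prime p; p \<noteq> 5; p dvd order G\<rbrakk> \<Longrightarrow> k p 5 dvd 6"
  shows "card (conjugates G Q) \<noteq> 6"
proof
  assume six: "card (conjugates G Q) = 6"
  have five: "Factorial_Ring.prime (5::nat)" by simp
  have sQ: "subgroup Q G" and cQ: "card Q = 5 ^ multiplicity 5 (order G)"
    using Q by (auto simp: sylow_subgroup_def)
  have QG: "Q \<subseteq> carrier G" using subgroup.subset[OF sQ] .
  let ?C = "centralizer G Q" and ?N = "normalizer G Q"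
  have sC: "subgroup ?C G" and sN: "subgroup ?N G"
    using subgroup_centralizer[OF QG] subgroup_normalizer[OF QG] .
  have cN: "6 * card ?N = order G" using card_conjugates[OF QG] six by simp
  have dvd720: "order G dvd 720"
    using order_dvd_fact_card_conjugates[OF QG] six by (simp add: fact_numeral)
  have "Q \<noteq> {\<one>}"
  proof
    assume "Q = {\<one>}"
    then have "?C = carrier G" by (auto simp: centralizer_def)
    then have "carrier G \<subseteq> ?N" using centralizer_subset_normalizer[OF QG] by simp
    then have "card ?N = order G"
      using subgroup.subset[OF sN] by (simp add: order_def subset_antisym)
    then show False using cN order_pos by simp
  qed
  \<comment> \<open>25 does not divide 720.\<close>
  have card5: "card Q = 5"
  proof -
    let ?e = "multiplicity 5 (order G)"
    have "?e \<noteq> 0" using cQ subgroup_eq_one_if_card_one[OF sQ] \<open>Q \<noteq> {\<one>}\<close> by fastforce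
    moreover have "\<not> ?e \<ge> 2"
    proof
      assume "?e \<ge> 2"
      then have "(5::nat) ^ 2 dvd 5 ^ ?e" by (rule le_imp_power_dvd)
      also have "(5::nat) ^ ?e dvd order G" by (rule multiplicity_dvd)
      also note dvd720
      finally show False by simp
    qed
    ultimately have "?e = 1" by linarith
    then show ?thesis using cQ by simp
  qed
  have pQ: "Factorial_Ring.prime (card Q)" using card5 by simp
  have QC: "Q \<subseteq> ?C"
  proof -
    obtain z where "z \<in> Q" "z \<noteq> \<one>" "z \<in> ?C"
      using prime_power_center_nontrivial[OF five sQ cQ \<open>Q \<noteq> {\<one>}\<close>] by blast
    then have "Q \<inter> ?C \<noteq> {\<one>}" by blast
    then have "Q \<inter> ?C = Q"
      using subgroup_of_prime_order[OF sQ subgroups_Inter_pair[OF sQ sC] Int_lower1 pQ] by simp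
    then show ?thesis by blast
  qed
  \<comment> \<open>\<open>Q\<close> has prime order and so lies in its own centralizer, which may
    thus replace the normalizer in the index bound.\<close>
  have ordC: "order G dvd 6 * card ?C"
    by (rule order_dvd_index_bound[OF k five Q sC QC subset_refl m])
  have "\<exists>Q'\<in>conjugates G Q. Q' \<noteq> Q"
  proof (rule ccontr)
    assume "\<not> ?thesis"
    then have "conjugates G Q \<subseteq> {Q}" by blast
    then have "card (conjugates G Q) \<le> 1" using card_mono[of "{Q}"] by simp
    then show False using six by simp
  qed
  then obtain Q' where Q': "Q' \<in> conjugates G Q" "Q' \<noteq> Q" by blast
  have sylQ': "sylow_subgroup G 5 Q'" using sylow_subgroup_conjugates[OF Q'(1) Q] .
  have sQ': "subgroup Q' G" using sylQ' by (simp add: sylow_subgroup_def)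
  have Q'G: "Q' \<subseteq> carrier G" using subgroup.subset[OF sQ'] .
  let ?C' = "centralizer G Q'"
  have sC': "subgroup ?C' G" using subgroup_centralizer[OF Q'G] .
  have cC': "card ?C' = card ?C"
  proof -
    obtain g where g: "g \<in> carrier G" "Q' = conj_set G g Q" using Q'(1) by (auto simp: conjugates_def)
    then show ?thesis using centralizer_conj_set[OF g(1) QG] card_conj_set[OF g(1) subgroup.subset[OF sC]]
      by simp
  qed
  \<comment> \<open>Since \<open>|Q|\<close> is prime, the alternative is that \<open>Q\<close>
    normalizes \<open>Q'\<close>, which would make them equal. Hence \<open>Q\<close> moves
    \<open>Q'\<close> to five different conjugates.\<close>
  have QN': "Q \<inter> normalizer G Q' = {\<one>}"
  proof (rule ccontr)
    assume "Q \<inter> normalizer G Q' \<noteq> {\<one>}"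
    then have "Q \<inter> normalizer G Q' = Q"
      using subgroup_of_prime_order[OF sQ subgroups_Inter_pair[OF sQ subgroup_normalizer[OF Q'G]] Int_lower1 pQ]
      by simp
    then have "Q \<subseteq> normalizer G Q'" by blast
    then have "Q \<subseteq> Q'" using prime_power_subgroup_normalizing_sylow[OF five sQ cQ sylQ'] by blast
    moreover have "card Q = card Q'" using Q sylQ' by (simp add: sylow_subgroup_def)
    ultimately have "Q = Q'" using card_subset_eq[OF finite_subset_carrier[OF Q'G]] by blast
    then show False using Q'(2) by simp
  qed
  \<comment> \<open>\<open>Q\<close> permutes its five other conjugates transitively, so whatever centralizes \<open>Q\<close> and \<open>Q'\<close>
    centralizes all Sylow 5-subgroups; simplicity then forces \<open>|C(Q)| \<le> 6\<close>, hence \<open>|G| = 30\<close>.\<close>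
  have trans: "(\<lambda>y. conj_set G y Q') ` Q = conjugates G Q - {Q}"
  proof (rule card_subset_eq)
    show "finite (conjugates G Q - {Q})" using finite_conjugates by simp
    show "(\<lambda>y. conj_set G y Q') ` Q \<subseteq> conjugates G Q - {Q}"
    proof clarify
      fix y assume y: "y \<in> Q"
      have yG: "y \<in> carrier G" using y QG by blast
      have "conj_set G y Q' \<noteq> Q"
      proof
        assume "conj_set G y Q' = Q"
        then have "conj_set G (inv y) Q = Q'" using conj_set_inv[OF yG Q'G] by simp
        moreover have "conj_set G (inv y) Q = Q"
          using conj_set_self[OF sQ subgroup.m_inv_closed[OF sQ y]] .
        ultimately show False using Q'(2) by simp
      qed
      then show "conj_set G y Q' \<in> conjugates G Q - {Q}"
        using conj_set_in_conjugates[OF QG Q'(1) yG] by simp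
    qed
    have "inj_on (\<lambda>y. conj_set G y Q') Q"
    proof (rule inj_onI)
      fix x y assume x: "x \<in> Q" and y: "y \<in> Q" and eq: "conj_set G x Q' = conj_set G y Q'"
      have G: "x \<in> carrier G" "y \<in> carrier G" using x y QG by blast+
      have "conj_set G (inv x \<otimes> y) Q' = conj_set G (inv x) (conj_set G x Q')"
        using eq conj_set_mult[of "inv x" y Q'] G Q'G by simp
      also have "\<dots> = Q'" using conj_set_inv[OF G(1) Q'G] .
      finally have "inv x \<otimes> y \<in> normalizer G Q'" using G Q'G by (simp add: normalizer_eq)
      moreover have "inv x \<otimes> y \<in> Q"
        using subgroup.m_closed[OF sQ subgroup.m_inv_closed[OF sQ x] y] .
      ultimately have "inv x \<otimes> y = \<one>" using QN' by blast
      then show "x = y" using inv_solve_left[of \<one> x y] G by simp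
    qed
    then show "card ((\<lambda>y. conj_set G y Q') ` Q) = card (conjugates G Q - {Q})"
      using card_image card5 six self_in_conjugates[OF QG] by (simp add: card_Diff_singleton card_image)
  qed
  \<comment> \<open>The elements centralizing every conjugate of \<open>Q\<close> form a normal
    subgroup, which simplicity makes trivial.\<close>
  define L where "L = {g \<in> carrier G. \<forall>B\<in>conjugates G Q. g \<in> centralizer G B}"
  have CL: "?C \<inter> ?C' \<subseteq> L"
  proof
    fix x assume x: "x \<in> ?C \<inter> ?C'"
    then have xG: "x \<in> carrier G" by (simp add: centralizer_def)
    have "x \<in> centralizer G B" if B: "B \<in> conjugates G Q" for B
    proof (cases "B = Q")
      case True
      then show ?thesis using x by simp
    next
      case False
      then have "B \<in> (\<lambda>y. conj_set G y Q') ` Q" using B trans by simp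
      then obtain y where y: "y \<in> Q" "B = conj_set G y Q'" by blast
      \<comment> \<open>The centralizer of \<open>x\<close> contains both \<open>y\<close> and
        \<open>Q'\<close>, hence the conjugate \<open>B\<close> of \<open>Q'\<close> by
        \<open>y\<close>.\<close>
      have sx: "subgroup (centralizer G {x}) G" using subgroup_centralizer[of "{x}"] xG by simp
      have yx: "y \<in> centralizer G {x}" using x y(1) QG by (auto simp: centralizer_def)
      have "b \<in> centralizer G {x}" if b: "b \<in> B" for b
      proof -
        obtain a where a: "a \<in> Q'" "b = y \<otimes> a \<otimes> inv y" using b y(2) by (auto simp: conj_set_def)
        then have "a \<in> centralizer G {x}" using x Q'G by (auto simp: centralizer_def)
        then show ?thesis using a(2) yx subgroup.m_closed[OF sx] subgroup.m_inv_closed[OF sx] by simp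
      qed
      then show ?thesis using xG by (simp add: centralizer_def)
    qed
    then show "x \<in> L" using xG by (simp add: L_def)
  qed
  have L_eq: "L = \<Inter>(centralizer G ` conjugates G Q)"
    using self_in_conjugates[OF QG] by (auto simp: L_def centralizer_def)
  have sL: "subgroup L G"
    unfolding L_eq
  proof (rule subgroups_Inter)
    show "centralizer G ` conjugates G Q \<noteq> {}" using self_in_conjugates[OF QG] by blast
    show "subgroup H G" if "H \<in> centralizer G ` conjugates G Q" for H
      using that subgroup_centralizer conjugates_subset[OF QG] by auto
  qed
  have "L \<lhd> G"
    unfolding normal_inv_iff
  proof (intro conjI sL ballI)
    fix g x assume g: "g \<in> carrier G" and x: "x \<in> L"
    have "g \<otimes> x \<otimes> inv g \<in> centralizer G B" if B: "B \<in> conjugates G Q" for B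
    proof -
      have BG: "B \<subseteq> carrier G" using conjugates_subset[OF QG B] .
      let ?B = "conj_set G (inv g) B"
      have "?B \<in> conjugates G Q" using conj_set_in_conjugates[OF QG B] g by simp
      then have "x \<in> centralizer G ?B" using x by (simp add: L_def)
      then have "g \<otimes> x \<otimes> inv g \<in> conj_set G g (centralizer G ?B)" by (simp add: conj_set_def)
      also have "\<dots> = centralizer G (conj_set G g ?B)"
        using centralizer_conj_set[OF g conj_set_subset[OF _ BG]] g by simp
      also have "conj_set G g ?B = B" using conj_set_inv[of "inv g" B] g BG by simp
      finally show ?thesis .
    qed
    then show "g \<otimes> x \<otimes> inv g \<in> L" using g x by (simp add: L_def)
  qed
  then have "L = carrier G \<or> L = {\<one>}" using no_real_normal_subgroup by blast
  moreover have "L \<noteq> carrier G"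
  proof
    assume "L = carrier G"
    then have "carrier G \<subseteq> ?C" using self_in_conjugates[OF QG] unfolding L_eq by blast
    then have "carrier G \<subseteq> ?N" using centralizer_subset_normalizer[OF QG] by simp
    then have "card ?N = order G"
      using subgroup.subset[OF sN] by (simp add: order_def subset_antisym)
    then show False using cN order_pos by simp
  qed
  ultimately have "?C \<inter> ?C' = {\<one>}"
    using CL subgroup.one_closed[OF sC] subgroup.one_closed[OF sC'] by blast
  \<comment> \<open>Two centralizers of equal order with trivial intersection give
    \<open>|C|^2 \<le> |G| \<le> 6 * |C|\<close>. As 5 divides \<open>|C|\<close>, only
    \<open>|C| = 5\<close> is left.\<close>
  then have "card ?C * card ?C \<le> order G"
    using card_mult_le_order_if_inter_trivial[OF sC sC'] cC' by simp
  also have "\<dots> \<le> 6 * card ?C" using ordC card_subgroup_pos[OF sC] by (intro dvd_imp_le) auto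
  finally have "card ?C \<le> 6" using card_subgroup_pos[OF sC] by simp
  moreover have "5 dvd card ?C" using card_subgroup_dvd_card_subgroup[OF sQ sC QC] card5 by simp
  ultimately have "card ?C = 5" using card_subgroup_pos[OF sC] by (auto simp: dvd_def)
  then have "order G dvd 30" using ordC by simp
  moreover have "30 dvd order G"
  proof -
    have "5 dvd card ?N"
      using card_subgroup_dvd_card_subgroup[OF sQ sN subgroup_subset_normalizer[OF sQ]] card5 by simp
    then have "6 * 5 dvd 6 * card ?N" by (intro mult_dvd_mono) simp_all
    then show ?thesis using cN by simp
  qed
  ultimately have ord: "order G = 30" using dvd_antisym by blast
  have three: "Factorial_Ring.prime (3::nat)" by simp
  obtain R where R: "sylow_subgroup G 3 R" using sylow_subgroup_exists[OF three] by blast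
  have "multiplicity 3 (30::nat) = 1" by (rule multiplicity_eqI) simp_all
  then have sR: "subgroup R G" and cR: "card R = 3" using R ord by (simp_all add: sylow_subgroup_def)
  have RG: "R \<subseteq> carrier G" using subgroup.subset[OF sR] .
  have n1: "card (conjugates G R) \<noteq> 1"
  proof
    assume "card (conjugates G R) = 1"
    then have "order G = 3 ^ multiplicity 3 (order G)"
      using order_prime_power_if_sylow_normal[OF three _ R] ord by simp
    then show False using ord \<open>multiplicity 3 (30::nat) = 1\<close> by simp
  qed
  have "card (conjugates G R) * 3 dvd 10 * 3"
    using card_conjugates_dvd_index[OF RG sR subgroup_subset_normalizer[OF sR]] ord cR by simp
  then have "card (conjugates G R) dvd 10" by simp
  moreover have "card (conjugates G R) mod 3 = 1"
    using card_conjugates_sylow_cong_1[OF three R] .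
  \<comment> \<open>Among the divisors 1, 2, 5, 10 only 1 and 10 are 1 modulo 3, and 1 is excluded
    by \<open>n1\<close>.\<close>
  ultimately have ten: "card (conjugates G R) \<ge> 10"
  proof -
    assume d: "card (conjugates G R) dvd 10" and m3: "card (conjugates G R) mod 3 = 1"
    have "card (conjugates G R) \<le> 10" using d by (rule dvd_imp_le) simp
    then have "card (conjugates G R) \<in> {0..10}" by simp
    then have "card (conjugates G R) \<in> {0,1,2,3,4,5,6,7,8,9,10}" by (simp add: atLeastAtMost_iff) presburger
    then show ?thesis using d m3 n1 by auto
  qed
  \<comment> \<open>There are 24 elements of order 5 and 20 of order 3, too many for a group of order 30.\<close>
  let ?UQ = "\<Union>B\<in>conjugates G Q. B - {\<one>}" and ?UR = "\<Union>B\<in>conjugates G R. B - {\<one>}"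
  have cUQ: "card ?UQ = 24" using card_Union_conjugates_prime_order[OF sQ pQ] six card5 by simp
  have "card ?UR = card (conjugates G R) * 2"
    using card_Union_conjugates_prime_order[OF sR] cR by simp
  then have cUR: "card ?UR \<ge> 20" using ten by simp
  have "?UQ \<inter> ?UR = {}"
  proof -
    have "(B - {\<one>}) \<inter> (B' - {\<one>}) = {}" if B: "B \<in> conjugates G Q" and B': "B' \<in> conjugates G R" for B B'
    proof -
      have s: "subgroup B G" "subgroup B' G" "card B = 5" "card B' = 3"
        using sylow_subgroup_conjugates[OF B Q] sylow_subgroup_conjugates[OF B' R] Q R card5 cR
        by (simp_all add: sylow_subgroup_def)
      have sub: "subgroup (B \<inter> B') G" using subgroups_Inter_pair[OF s(1,2)] .
      have "card (B \<inter> B') dvd 5" "card (B \<inter> B') dvd 3"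
        using card_subgroup_dvd_card_subgroup[OF sub s(1)] card_subgroup_dvd_card_subgroup[OF sub s(2)] s(3,4)
        by simp_all
      then have "card (B \<inter> B') dvd gcd 5 3" by (rule gcd_greatest)
      moreover have "gcd 5 3 = (1::nat)" by (simp add: gcd_non_0_nat)
      ultimately have "card (B \<inter> B') = 1" by simp
      then show ?thesis using subgroup_eq_one_if_card_one[OF sub] by blast
    qed
    then show ?thesis by blast
  qed
  moreover have fin: "finite ?UQ" "finite ?UR" and sub: "?UQ \<union> ?UR \<subseteq> carrier G"
  proof -
    show sub: "?UQ \<union> ?UR \<subseteq> carrier G"
      using conjugates_subset[OF QG] conjugates_subset[OF RG] by blast
    then show "finite ?UQ" "finite ?UR"
      using finite_subset_carrier[of ?UQ] finite_subset_carrier[of ?UR] by blast+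
  qed
  ultimately have "card (?UQ \<union> ?UR) \<ge> 44" using cUQ cUR by (simp add: card_Un_disjoint)
  moreover have "card (?UQ \<union> ?UR) \<le> 30"
    using card_mono[OF finite_carrier sub] ord by (simp add: order_def)
  ultimately show False by simp
qed

end

text \<open>
  If \<open>Pr(P, Q) > 2/5\<close> and \<open>t = |P : C\<^sub>P(Q)|\<close>, then \<open>t (2q - 5) < 5 (q - 1)\<close>. This gives \<open>t < 4\<close>
  for \<open>q \<ge> 5\<close> and \<open>t < 10\<close> for \<open>q = 3\<close>; a prime power below 4 divides 6, a power of 2 below
  10 divides 8. The value 0 imposes no condition.
\<close>
definition sylow_commuting_bound :: "nat \<Rightarrow> nat \<Rightarrow> nat" where
  "sylow_commuting_bound p q = (if q \<ge> 5 then 6 else if q = 3 \<and> p = 2 then 8 else 0)"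

section \<open>Solubility of simple groups satisfying the bounds\<close>

lemma prime_nat_lt_5: "Factorial_Ring.prime (p::nat) \<Longrightarrow> p < 5 \<Longrightarrow> p = 2 \<or> p = 3"
proof -
  assume p: "Factorial_Ring.prime p" and "p < 5"
  then have "p \<in> {2, 3, 4}" using prime_ge_2_nat[OF p] by auto
  moreover have "\<not> Factorial_Ring.prime (4::nat)" by (simp add: prime_nat_iff) (auto intro!: exI[of _ 2])
  ultimately show ?thesis using p by auto
qed

lemma dvd_6_cases: "(n::nat) dvd 6 \<Longrightarrow> n = 1 \<or> n = 2 \<or> n = 3 \<or> n = 6"
proof -
  assume d: "n dvd 6"
  then have "n \<le> 6" by (rule dvd_imp_le) simp
  then consider "n = 0" | "n = 1" | "n = 2" | "n = 3" | "n = 4" | "n = 5" | "n = 6" by linarith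
  then show ?thesis using d by cases auto
qed

theorem (in finite_simple_group) simple_solvable_if_sylows_almost_commute:
  assumes k: "sylows_commute_up_to sylow_commuting_bound G"
  shows "solvable G"
proof (cases "\<exists>r. Factorial_Ring.prime r \<and> r \<ge> 5 \<and> r dvd order G")
  case True
  then obtain r where r: "Factorial_Ring.prime r" "r \<ge> 5" "r dvd order G" by blast
  obtain Q where Q: "sylow_subgroup G r Q" using sylow_subgroup_exists[OF r(1)] by blast
  have "card (conjugates G Q) dvd 6"
    by (rule card_conjugates_sylow_dvd[OF k r(1) Q]) (use r in \<open>simp add: sylow_commuting_bound_def\<close>)
  moreover have cong: "card (conjugates G Q) mod r = 1" using card_conjugates_sylow_cong_1[OF r(1) Q] .
  moreover have "card (conjugates G Q) \<noteq> 6"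
  proof
    assume six: "card (conjugates G Q) = 6"
    \<comment> \<open>A prime \<open>r\<close> with 6 congruent to 1 modulo \<open>r\<close> divides
      5.\<close>
    have "r = 5"
    proof (rule ccontr)
      assume "r \<noteq> 5"
      then have "r \<ge> 6" using r by simp
      then show False using cong six by (cases "r = 6") auto
    qed
    then show False
      using card_conjugates_sylow_5_neq_6[OF k, of Q] Q six by (simp add: sylow_commuting_bound_def)
  qed
  \<comment> \<open>The divisors 2 and 3 of 6 are smaller than \<open>r\<close>, so they are not 1
    modulo \<open>r\<close>.\<close>
  ultimately have "card (conjugates G Q) = 1"
    using dvd_6_cases[of "card (conjugates G Q)"] r(2) by auto
  then show ?thesis
    using solvable_if_order_prime_power[OF r(1)] order_prime_power_if_sylow_normal[OF r(1,3) Q] by blast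
next
  case False
  then have small: "p = 2 \<or> p = 3" if "Factorial_Ring.prime p" "p dvd order G" for p
    using that prime_nat_lt_5[of p] by (meson not_le)
  have two: "Factorial_Ring.prime (2::nat)" and three: "Factorial_Ring.prime (3::nat)" by simp_all
  obtain P where P: "sylow_subgroup G 2 P" using sylow_subgroup_exists[OF two] by blast
  have sP: "subgroup P G" and cP: "card P = 2 ^ multiplicity 2 (order G)"
    using P by (auto simp: sylow_subgroup_def)
  show ?thesis
  proof (cases "3 dvd order G")
    case True
    obtain R where R: "sylow_subgroup G 3 R" using sylow_subgroup_exists[OF three] by blast
    have RG: "R \<subseteq> carrier G" using R by (simp add: sylow_subgroup_def subgroup.subset)
    have dvd8: "card (conjugates G R) dvd 8"
      by (rule card_conjugates_sylow_dvd[OF k three R])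
        (use small in \<open>auto simp: sylow_commuting_bound_def\<close>)
    have cong: "card (conjugates G R) mod 3 = 1" using card_conjugates_sylow_cong_1[OF three R] .
    have "card (conjugates G R) \<le> 8" using dvd8 by (rule dvd_imp_le) simp
    \<comment> \<open>These are the numbers up to 8 that are 1 modulo 3; 7 falls below because it
      does not divide 8.\<close>
    then have "card (conjugates G R) = 1 \<or> card (conjugates G R) = 4 \<or> card (conjugates G R) = 7"
      using cong by presburger
    then consider "card (conjugates G R) = 1" | "card (conjugates G R) = 4" | "card (conjugates G R) = 7"
      by blast
    then show ?thesis
    proof cases
      case 1
      then show ?thesis
        using solvable_if_order_prime_power[OF three] order_prime_power_if_sylow_normal[OF three True R]
        by blast
    next
      case 2
      \<comment> \<open>24 is \<open>4!\<close>, from the faithful action on the four Sylow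
        3-subgroups.\<close>
      have dvd24: "order G dvd 24"
        using order_dvd_fact_card_conjugates[OF RG] 2 by (simp add: fact_numeral)
      have four: "4 dvd order G" using card_conjugates[OF RG] 2 by (metis dvd_triv_left)
      have PG: "P \<subseteq> carrier G" using subgroup.subset[OF sP] .
      let ?n = "card (conjugates G P)"
      have n24: "?n dvd 24" using card_conjugates[OF PG] dvd24 by (metis dvd_triv_left dvd_trans)
      have odd: "?n mod 2 = 1" using card_conjugates_sylow_cong_1[OF two P] .
      have "coprime ?n 2" using odd by (simp add: coprime_right_2_iff_odd odd_iff_mod_2_eq_one)
      then have "coprime ?n (2 ^ 3)" by (rule coprime_power_right_iff[THEN iffD2, OF disjI1])
      moreover have "?n dvd 2 ^ 3 * 3" using n24 by simp
      ultimately have "?n dvd 3" using coprime_dvd_mult_right_iff by blast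
      then have "?n = 1 \<or> ?n = 3" using three by (simp add: prime_nat_iff)
      then show ?thesis
      proof
        assume "?n = 1"
        have "2 dvd order G" using four by (meson dvd_trans even_numeral)
        then show ?thesis
          using solvable_if_order_prime_power[OF two] \<open>?n = 1\<close>
            order_prime_power_if_sylow_normal[OF two _ P] by blast
      next
        assume "?n = 3"
        \<comment> \<open>Likewise 6 is \<open>3!\<close>, from three Sylow 2-subgroups; this
          contradicts \<open>four\<close>.\<close>
        then have "order G dvd 6" using order_dvd_fact_card_conjugates[OF PG] by (simp add: fact_numeral)
        then have "4 dvd (6::nat)" using four dvd_trans by blast
        then show ?thesis by simp
      qed
    next
      case 3
      then show ?thesis using dvd8 by simp
    qed
  next
    case False
    \<comment> \<open>Only the prime 2 can divide the order here, so the Sylow 2-subgroup is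
      everything.\<close>
    have "order G dvd card P"
    proof (rule dvd_if_prime_powers_dvd[OF order_pos])
      fix p :: nat assume p: "Factorial_Ring.prime p"
      show "p ^ multiplicity p (order G) dvd card P"
      proof (cases "p dvd order G")
        case True
        then show ?thesis using small[OF p] False cP by auto
      qed (simp add: not_dvd_imp_multiplicity_0)
    qed
    then have "P = carrier G" using card_subgroup_eq_order[OF sP] by blast
    then have "order G = 2 ^ multiplicity 2 (order G)" using cP by (simp add: order_def)
    then show ?thesis using solvable_if_order_prime_power[OF two] by blast
  qed
qed

section \<open>Solubility\<close>

lemma (in finite_group) ex_maximal_normal_subgroup:
  assumes "order G > 1"
  shows "\<exists>M. M \<lhd> G \<and> M \<noteq> carrier G \<and> (\<forall>L. L \<lhd> G \<longrightarrow> M \<subseteq> L \<longrightarrow> L = M \<or> L = carrier G)"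
proof -
  let ?S = "{M. M \<lhd> G \<and> M \<noteq> carrier G}"
  have "?S \<subseteq> Pow (carrier G)" using normal_imp_subgroup subgroup.subset by blast
  then have fin: "finite ?S" using finite_carrier by (meson finite_Pow_iff finite_subset)
  have "{\<one>} \<in> ?S" using one_is_normal assms by (auto simp: order_def dest: sym)
  then obtain M where M: "M \<in> ?S" and max: "\<And>L. L \<in> ?S \<Longrightarrow> M \<subseteq> L \<Longrightarrow> L = M"
    using finite_has_maximal[OF fin] by blast
  then show ?thesis by blast
qed

text \<open>The preimage \<open>\<Union>A\<close> of a normal subgroup \<open>A\<close> of the
  quotient is normal and contains \<open>M\<close>, so maximality leaves two choices; the cosets in
  \<open>A\<close> are recovered from its preimage.\<close>

lemma (in finite_group) simple_Mod_maximal_normal_subgroup: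
  assumes M: "M \<lhd> G" "M \<noteq> carrier G"
    and max: "\<And>L. L \<lhd> G \<Longrightarrow> M \<subseteq> L \<Longrightarrow> L = M \<or> L = carrier G"
  shows "finite_simple_group (G Mod M)"
proof -
  interpret M: normal M G by (rule M(1))
  interpret Q: finite_group "G Mod M" using M.finite_group_Mod[OF finite_carrier] .
  have ord: "order (G Mod M) * card M = order G"
    using lagrange[OF M.is_subgroup] by (simp add: order_def FactGroup_def)
  have "order (G Mod M) \<noteq> 1"
    using ord M(2) card_subgroup_eq_order[OF M.is_subgroup] by auto
  then have gt: "order (G Mod M) > 1" using Q.order_pos by linarith
  have one: "\<one>\<^bsub>G Mod M\<^esub> = M" by (simp add: FactGroup_def)
  show ?thesis
  proof (intro finite_simple_group.intro Q.finite_group_axioms simple_group.intro Q.is_group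
      simple_group_axioms.intro gt)
    fix A assume A: "A \<lhd> G Mod M"
    have sA: "subgroup A (G Mod M)" using normal_imp_subgroup[OF A] .
    have U: "\<Union>A = {x \<in> carrier G. M #> x \<in> A}" by (rule M.factgroup_subgroup_union_char[OF sA])
    have "M \<subseteq> \<Union>A" using subgroup.one_closed[OF sA] one by auto
    then have "\<Union>A = M \<or> \<Union>A = carrier G" using max[OF M.factgroup_subgroup_union_normal[OF A]] by blast
    then show "A = carrier (G Mod M) \<or> A = {\<one>\<^bsub>G Mod M\<^esub>}"
    proof
      assume UM: "\<Union>A = M"
      have "a = M" if a: "a \<in> A" for a
      proof -
        have "a \<in> (\<lambda>x. M #> x) ` carrier G"
          using subgroup.mem_carrier[OF sA a] unfolding M.r_coset_surj .
        then obtain x where x: "x \<in> carrier G" "a = M #> x" by blast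
        have "x \<in> \<Union>A" unfolding U using x a by simp
        then have "x \<in> M" using UM by simp
        then show ?thesis using x coset_join2[OF x(1) M.is_subgroup] by simp
      qed
      then have "A \<subseteq> {M}" by blast
      moreover have "M \<in> A" using subgroup.one_closed[OF sA] unfolding one .
      ultimately have "A = {M}" by blast
      then show ?thesis unfolding one by (rule disjI2)
    next
      assume UG: "\<Union>A = carrier G"
      have "a \<in> A" if a: "a \<in> carrier (G Mod M)" for a
      proof -
        have "a \<in> (\<lambda>x. M #> x) ` carrier G" using a unfolding M.r_coset_surj .
        then obtain x where x: "x \<in> carrier G" "a = M #> x" by blast
        have "x \<in> \<Union>A" using x(1) UG by simp
        then show ?thesis unfolding U using x(2) by simp
      qed
      then show ?thesis using subgroup.subset[OF sA] by blast
    qed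
  qed
qed

text \<open>Solubility is an extension property, and both \<open>M\<close> and
  \<open>G Mod M\<close> inherit the bounds. The induction hypothesis covers \<open>M\<close>, which
  keeps the type of \<open>G\<close>; the quotient consists of cosets and has another type, so
  \<open>M\<close> is chosen maximal to make the quotient simple.\<close>

theorem solvable_if_sylows_almost_commute:
  fixes G :: "('a, 'b) monoid_scheme"
  assumes "finite_group G" "sylows_commute_up_to sylow_commuting_bound G"
  shows "solvable G"
  using assms
proof (induction "order G" arbitrary: G rule: less_induct)
  case less
  interpret finite_group G by (rule less.prems(1))
  show ?case
  proof (cases "order G = 1")
    case True
    then have "(derived G ^^ 0) (carrier G) = {\<one>\<^bsub>G\<^esub>}"
      using subgroup_eq_one_if_card_one[OF subgroup_self] by (simp add: order_def)
    then show ?thesis unfolding solvable_iff_trivial_derived_seq by blast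
  next
    case False
    then have "order G > 1" using order_pos by linarith
    then obtain M where M: "M \<lhd> G" "M \<noteq> carrier G"
      and max: "\<And>L. L \<lhd> G \<Longrightarrow> M \<subseteq> L \<Longrightarrow> L = M \<or> L = carrier G"
      using ex_maximal_normal_subgroup by blast
    interpret M: normal M G by (rule M(1))
    interpret Q: finite_simple_group "G Mod M"
      by (rule simple_Mod_maximal_normal_subgroup[OF M max])
    have "sylows_commute_up_to sylow_commuting_bound (G Mod M)"
      by (rule sylows_commute_up_to_image[OF finite_group_axioms Q.finite_group_axioms
            M.r_coset_group_hom M.r_coset_surj less.prems(2)])
    then have sQ: "solvable (G Mod M)" by (rule Q.simple_solvable_if_sylows_almost_commute)
    have fM: "finite_group (G\<lparr>carrier := M\<rparr>)" using finite_group_subgroup[OF M.is_subgroup] .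
    have "order (G\<lparr>carrier := M\<rparr>) < order G"
      using psubset_card_mono[OF finite_carrier, of M] M(2) M.subset by (simp add: order_def psubset_eq)
    then have sM: "solvable (G\<lparr>carrier := M\<rparr>)"
      using less.hyps fM sylows_commute_up_to_normal[OF finite_group_axioms M(1) less.prems(2)] by blast
    have "group_hom (G\<lparr>carrier := M\<rparr>) G (\<lambda>x. x)"
      using finite_group.axioms(1)[OF fM] M.subset
      by (intro group_hom.intro group_hom_axioms.intro is_group) (auto simp: hom_def)
    then show ?thesis
      using solvable_condition[OF _ M.r_coset_group_hom M.r_coset_surj _ sM sQ] M.kernel_r_coset by simp
  qed
qed

section \<open>Commuting probability\<close>

text \<open>Count by the first component. An element of \<open>C\<^sub>P(Q)\<close> pairs with all
  of \<open>Q\<close>; any other one has a proper centralizer in \<open>Q\<close>, of order at most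
  \<open>|Q| / q\<close>. The factor \<open>q\<close> on both sides avoids division in the
  naturals.\<close>

lemma (in finite_group) card_commuting_pairs_le:
  assumes P: "subgroup P G" and Q: "subgroup Q G" and q: "Factorial_Ring.prime (q::nat)"
    and cQ: "card Q = q ^ b"
  shows "q * card {(x, y). x \<in> P \<and> y \<in> Q \<and> x \<otimes> y = y \<otimes> x}
    \<le> (q * card (P \<inter> centralizer G Q) + (card P - card (P \<inter> centralizer G Q))) * card Q"
proof -
  let ?D = "P \<inter> centralizer G Q" and ?C = "\<lambda>x. Q \<inter> centralizer G {x}"
  have PG: "P \<subseteq> carrier G" and QG: "Q \<subseteq> carrier G" using P Q subgroup.subset by blast+
  have fP: "finite P" and fQ: "finite Q" using PG QG finite_subset_carrier by blast+
  have "{(x, y). x \<in> P \<and> y \<in> Q \<and> x \<otimes> y = y \<otimes> x} = Sigma P ?C"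
    using QG by (auto simp: centralizer_def)
  then have "q * card {(x, y). x \<in> P \<and> y \<in> Q \<and> x \<otimes> y = y \<otimes> x} = (\<Sum>x\<in>P. q * card (?C x))"
    using fP fQ by (simp add: card_SigmaI sum_distrib_left)
  also have "\<dots> = (\<Sum>x\<in>?D. q * card (?C x)) + (\<Sum>x\<in>P - ?D. q * card (?C x))"
    using sum.subset_diff[of ?D P "\<lambda>x. q * card (?C x)"] fP by (simp add: add.commute)
  also have "\<dots> \<le> (\<Sum>x\<in>?D. q * card Q) + (\<Sum>x\<in>P - ?D. card Q)"
  proof (intro add_mono sum_mono)
    fix x assume "x \<in> ?D"
    show "q * card (?C x) \<le> q * card Q" using fQ by (simp add: card_mono)
  next
    fix x assume x: "x \<in> P - ?D"
    then have xG: "x \<in> carrier G" using PG by blast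
    have sC: "subgroup (?C x) G"
      using subgroups_Inter_pair[OF Q subgroup_centralizer[of "{x}"]] xG by simp
    have "?C x \<noteq> Q"
    proof
      assume eq: "?C x = Q"
      have "x \<otimes> y = y \<otimes> x" if "y \<in> Q" for y
      proof -
        have "y \<in> ?C x" using that eq by simp
        then show ?thesis by (simp add: centralizer_def)
      qed
      then have "x \<in> ?D" using x xG by (simp add: centralizer_def)
      then show False using x by blast
    qed
    then have lt: "card (?C x) < card Q" using fQ by (intro psubset_card_mono) blast+
    have "card (?C x) dvd q ^ b"
      using card_subgroup_dvd_card_subgroup[OF sC Q Int_lower1] cQ by simp
    then obtain i where i: "card (?C x) = q ^ i" using divides_primepow_nat[OF q] by blast
    have q1: "q > 1" using q prime_gt_1_nat by blast
    have "i < b" using lt q1 unfolding i cQ by simp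
    then have "q ^ Suc i \<le> q ^ b" using q1 by (intro power_increasing) auto
    then show "q * card (?C x) \<le> card Q" using i cQ by simp
  qed
  also have "\<dots> = (q * card ?D + (card P - card ?D)) * card Q"
    using fP by (simp add: card_Diff_subset algebra_simps)
  finally show ?thesis .
qed

text \<open>With \<open>t = p ^ j\<close> the index of \<open>C\<^sub>P(Q)\<close> in
  \<open>P\<close>, dividing the pair count by \<open>q * |P| * |Q|\<close> bounds the probability
  by \<open>(q + t - 1) / (q * t)\<close>.\<close>

lemma (in finite_group) index_bound_if_comm_prob_gt:
  assumes P: "sylow_subgroup G p P" and Q: "sylow_subgroup G q Q"
    and p: "Factorial_Ring.prime (p::nat)" and q: "Factorial_Ring.prime (q::nat)"
    and gt: "comm_prob G P Q > \<epsilon>"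
  obtains j where "card P = p ^ j * card (P \<inter> centralizer G Q)"
    and "\<epsilon> * real q * real (p ^ j) < real q + real (p ^ j) - 1"
proof -
  let ?D = "P \<inter> centralizer G Q"
  have sP: "subgroup P G" and sQ: "subgroup Q G" and cP: "card P = p ^ multiplicity p (order G)"
    and cQ: "card Q = q ^ multiplicity q (order G)"
    using P Q by (auto simp: sylow_subgroup_def)
  have sD: "subgroup ?D G"
    using subgroups_Inter_pair[OF sP subgroup_centralizer[OF subgroup.subset[OF sQ]]] .
  have "card ?D dvd card P" using card_subgroup_dvd_card_subgroup[OF sD sP Int_lower1] .
  then obtain t where t: "card P = t * card ?D" by (metis dvd_def mult.commute)
  then have "t dvd p ^ multiplicity p (order G)" using cP by (metis dvd_triv_left)
  then obtain j where j: "t = p ^ j" using divides_primepow_nat[OF p] by blast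
  define d where "d = real (card ?D)"
  have d: "d > 0" and Q0: "real (card Q) > 0" and P0: "real (card P) > 0"
    using card_subgroup_pos[OF sD] card_subgroup_pos[OF sQ] card_subgroup_pos[OF sP] by (auto simp: d_def)
  let ?c = "card {(x, y). x \<in> P \<and> y \<in> Q \<and> x \<otimes> y = y \<otimes> x}"
  have "card ?D \<le> card P"
    using finite_subset_carrier[OF subgroup.subset[OF sP]] by (intro card_mono) auto
  then have "real (q * ?c) \<le> (real q * d + (real (card P) - d)) * real (card Q)"
    using of_nat_mono[OF card_commuting_pairs_le[OF sP sQ q cQ], where 'a = real]
    by (simp add: d_def of_nat_diff add_diff_eq)
  moreover have "real (card P) = real t * d" using t by (simp add: d_def)
  ultimately have le: "real q * real ?c \<le> (real q + real t - 1) * d * real (card Q)"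
    by (simp add: algebra_simps)
  have "\<epsilon> * (real (card P) * real (card Q)) < real ?c"
    using gt P0 Q0 by (simp add: comm_prob_def field_simps)
  then have "real q * (\<epsilon> * (real t * d * real (card Q))) < real q * real ?c"
    using \<open>real (card P) = real t * d\<close> q by (simp add: prime_gt_0_nat)
  with le have "(\<epsilon> * real q * real t) * (d * real (card Q)) < (real q + real t - 1) * (d * real (card Q))"
    by (simp add: algebra_simps)
  then have "\<epsilon> * real q * real t < real q + real t - 1"
    using d Q0 by (simp add: mult_less_cancel_right)
  then show ?thesis using that t j by blast
qed

text \<open>\<open>GREATEST\<close> is informative only if a greatest element exists. There are
  infinitely many pairs of primes, but all the probabilities come from pairs of subsets of a finite
  carrier, so they take finitely many values. Hence the minimum over prime pairs of the best
  probability exists, and it equals \<open>pr_star\<close>.\<close>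

lemma (in finite_group) comm_prob_ge_pr_star:
  assumes "Factorial_Ring.prime (p::nat)" "Factorial_Ring.prime (q::nat)" "p \<noteq> q"
  shows "\<exists>P Q. sylow_subgroup G p P \<and> sylow_subgroup G q Q \<and> comm_prob G P Q \<ge> pr_star G"
proof -
  let ?V = "(\<lambda>(P, Q). comm_prob G P Q) ` (Pow (carrier G) \<times> Pow (carrier G))"
  have fV: "finite ?V" using finite_carrier by simp
  define W where "W p q = {comm_prob G P Q | P Q. sylow_subgroup G p P \<and> sylow_subgroup G q Q}"
    for p q :: nat
  have WV: "W p q \<subseteq> ?V" for p q
    unfolding W_def sylow_subgroup_def by (force dest: subgroup.subset)
  have fW: "finite (W p q)" for p q using WV fV by (rule finite_subset)
  have neW: "W p q \<noteq> {}" if "Factorial_Ring.prime p" "Factorial_Ring.prime q" for p q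
    using sylow_subgroup_exists[OF that(1)] sylow_subgroup_exists[OF that(2)] unfolding W_def by blast
  define S where "S = {Max (W p q) | p q. Factorial_Ring.prime p \<and> Factorial_Ring.prime q \<and> p \<noteq> q}"
  have MaxW: "Max (W p q) \<in> W p q" if "Factorial_Ring.prime p" "Factorial_Ring.prime q" for p q
    using Max_in[OF fW neW[OF that]] .
  have "S \<subseteq> ?V" using MaxW WV unfolding S_def by blast
  then have fS: "finite S" using fV by (rule finite_subset)
  \<comment> \<open>Any two distinct primes would do, since Sylow subgroups are defined also for
    primes not dividing the order.\<close>
  have "Max (W 2 3) \<in> S" unfolding S_def by force
  then have neS: "S \<noteq> {}" by blast
  let ?good = "\<lambda>\<epsilon>. \<forall>p q. Factorial_Ring.prime (p::nat) \<and> Factorial_Ring.prime (q::nat) \<and> p \<noteq> q \<longrightarrow>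
       (\<exists>P Q. sylow_subgroup G p P \<and> sylow_subgroup G q Q \<and> comm_prob G P Q \<ge> \<epsilon>)"
  have good: "?good (Min S)"
  proof (intro allI impI)
    fix p q :: nat assume pq: "Factorial_Ring.prime p \<and> Factorial_Ring.prime q \<and> p \<noteq> q"
    then have "Max (W p q) \<in> S" unfolding S_def by blast
    then have "Min S \<le> Max (W p q)" using Min_le[OF fS] by blast
    moreover have "Max (W p q) \<in> W p q" using MaxW pq by blast
    then obtain P Q where "Max (W p q) = comm_prob G P Q" "sylow_subgroup G p P" "sylow_subgroup G q Q"
      unfolding W_def by blast
    ultimately show "\<exists>P Q. sylow_subgroup G p P \<and> sylow_subgroup G q Q \<and> comm_prob G P Q \<ge> Min S"
      by auto
  qed
  have "pr_star G = Min S"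
    unfolding pr_star_def
  proof (rule Greatest_equality[where P = ?good, OF good])
    fix \<epsilon> assume e: "?good \<epsilon>"
    have "Min S \<in> S" using Min_in[OF fS neS] .
    then obtain p q where pq: "Factorial_Ring.prime p" "Factorial_Ring.prime q" "p \<noteq> q" "Min S = Max (W p q)"
      unfolding S_def by blast
    then obtain P Q where PQ: "sylow_subgroup G p P" "sylow_subgroup G q Q" "comm_prob G P Q \<ge> \<epsilon>"
      using e by blast
    then have "comm_prob G P Q \<in> W p q" unfolding W_def by blast
    then have "comm_prob G P Q \<le> Max (W p q)" using Max_ge[OF fW] by blast
    then show "\<epsilon> \<le> Min S" using PQ(3) pq(4) by simp
  qed
  then show ?thesis using good assms by simp
qed

text \<open>\<open>a\<close> and \<open>b\<close> bound the two primes from below in some order. The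
  threshold decreases in both arguments, so it may be replaced by the one at \<open>p\<close> and
  \<open>q\<close>, where the index bound becomes \<open>t < p\<close> for the power
  \<open>t\<close> of \<open>p\<close>, that is \<open>t = 1\<close>.\<close>

lemma (in finite_group) sylows_commute_if_pr_star_gt:
  fixes a b :: nat
  assumes ab: "a \<ge> 1" "b \<ge> 1"
    and bound: "\<And>p q. \<lbrakk>Factorial_Ring.prime p; Factorial_Ring.prime q; p \<noteq> q; p dvd order G; q dvd order G\<rbrakk>
      \<Longrightarrow> (a \<le> p \<and> b \<le> q) \<or> (a \<le> q \<and> b \<le> p)"
    and gt: "pr_star G > (real a + real b - 1) / (real a * real b)"
  shows "sylows_commute_up_to (\<lambda>_ _. 1) G"
  unfolding sylows_commute_up_to_def
proof (intro allI impI)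
  fix p q :: nat
  assume p: "Factorial_Ring.prime p" and q: "Factorial_Ring.prime q" and pq: "p \<noteq> q"
  obtain P Q where P: "sylow_subgroup G p P" and Q: "sylow_subgroup G q Q"
    and ge: "comm_prob G P Q \<ge> pr_star G"
    using comm_prob_ge_pr_star[OF p q pq] by blast
  have "card P dvd 1 * card (P \<inter> centralizer G Q)"
  proof (cases "p dvd order G \<and> q dvd order G")
    case True
    \<comment> \<open>The quotient is \<open>1 - (1 - 1/x) * (1 - 1/y)\<close>, visibly decreasing
      in \<open>x\<close> and \<open>y\<close>.\<close>
    have mono: "(real x + real y - 1) / (real x * real y) \<le> (real a + real b - 1) / (real a * real b)"
      if "a \<le> x" "b \<le> y" for x y :: nat
    proof -
      have "(1 - 1 / real a) * (1 - 1 / real b) \<le> (1 - 1 / real x) * (1 - 1 / real y)"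
        using that ab by (intro mult_mono) (auto simp: field_simps)
      moreover have "(real u + real v - 1) / (real u * real v) = 1 - (1 - 1 / real u) * (1 - 1 / real v)"
        if "u \<ge> 1" "v \<ge> 1" for u v :: nat using that by (simp add: field_simps)
      ultimately show ?thesis using that ab by simp
    qed
    have "(real p + real q - 1) / (real p * real q) \<le> (real a + real b - 1) / (real a * real b)"
      using bound[OF p q pq] True mono[of p q] mono[of q p] by (auto simp: add.commute mult.commute)
    then have gt': "comm_prob G P Q > (real p + real q - 1) / (real p * real q)" using gt ge by linarith
    obtain j where j: "card P = p ^ j * card (P \<inter> centralizer G Q)"
      and lt: "(real p + real q - 1) / (real p * real q) * real q * real (p ^ j) < real q + real (p ^ j) - 1"
      using index_bound_if_comm_prob_gt[OF P Q p q gt'] .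
    have p1: "p > 1" and q1: "q > 1" using p q prime_gt_1_nat by blast+
    have "(real p + real q - 1) / (real p * real q) * real q * real (p ^ j)
        = (real p + real q - 1) * real (p ^ j) / real p"
      using q1 by simp
    with lt have "(real p + real q - 1) * real (p ^ j) < (real q + real (p ^ j) - 1) * real p"
      using p1 by (simp only: pos_divide_less_eq of_nat_0_less_iff)
    \<comment> \<open>The product \<open>p * p ^ j\<close> occurs on both sides and cancels.\<close>
    then have "(real q - 1) * real (p ^ j) < (real q - 1) * real p" by (simp add: algebra_simps)
    then have "real (p ^ j) < real p" using q1 by (simp add: mult_less_cancel_left)
    then have "p ^ j < p ^ 1" by (simp only: of_nat_less_iff power_one_right)
    then have "j = 0" using p1 power_less_imp_less_exp[of p j 1] by simp
    then show ?thesis using j by simp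
  next
    case False
    then consider "\<not> p dvd order G" | "\<not> q dvd order G" by blast
    then show ?thesis
    proof cases
      case 1
      then show ?thesis using P by (simp add: sylow_subgroup_def not_dvd_imp_multiplicity_0)
    next
      case 2
      then have "card Q = 1" "subgroup Q G"
        using Q by (simp_all add: sylow_subgroup_def not_dvd_imp_multiplicity_0)
      then have "Q = {\<one>}" using subgroup_eq_one_if_card_one by blast
      then have "P \<inter> centralizer G Q = P"
        using P by (auto simp: centralizer_def sylow_subgroup_def subgroup.mem_carrier)
      then show ?thesis by simp
    qed
  qed
  then show "\<exists>P Q. sylow_subgroup G p P \<and> sylow_subgroup G q Q \<and> card P dvd 1 * card (P \<inter> centralizer G Q)"
    using P Q by blast
qed

lemma (in finite_group) sylows_almost_commute_if_pr_star_gt: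
  assumes gt: "pr_star G > 2 / 5"
  shows "sylows_commute_up_to sylow_commuting_bound G"
  unfolding sylows_commute_up_to_def
proof (intro allI impI)
  fix p q :: nat
  assume p: "Factorial_Ring.prime p" and q: "Factorial_Ring.prime q" and pq: "p \<noteq> q"
  obtain P Q where P: "sylow_subgroup G p P" and Q: "sylow_subgroup G q Q"
    and ge: "comm_prob G P Q \<ge> pr_star G"
    using comm_prob_ge_pr_star[OF p q pq] by blast
  then have gt': "comm_prob G P Q > 2 / 5" using gt by linarith
  obtain j where j: "card P = p ^ j * card (P \<inter> centralizer G Q)"
    and lt: "2 / 5 * real q * real (p ^ j) < real q + real (p ^ j) - 1"
    using index_bound_if_comm_prob_gt[OF P Q p q gt'] .
  have p1: "p > 1" using p prime_gt_1_nat by blast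
  have "p ^ j dvd sylow_commuting_bound p q"
  proof -
    consider "q \<ge> 5" | "q = 3" "p = 2" | "q < 5" "\<not> (q = 3 \<and> p = 2)" by linarith
    then show ?thesis
    proof cases
      case 1
      \<comment> \<open>The inequality reads \<open>t * (2 * q - 5) < 5 * (q - 1)\<close>, and
        \<open>4 * (2 * q - 5) \<ge> 5 * (q - 1)\<close> holds exactly from \<open>q = 5\<close>
        on.\<close>
      have "p ^ j < 4"
      proof (rule ccontr)
        assume "\<not> p ^ j < 4"
        then have "real (p ^ j) \<ge> 4" by (metis not_less of_nat_le_iff of_nat_numeral)
        then have "real (p ^ j) * (2 * real q - 5) \<ge> 4 * (2 * real q - 5)"
          using 1 by (intro mult_right_mono) auto
        then show False using lt 1 by (simp add: algebra_simps)
      qed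
      moreover have "p ^ j > 0" using p1 by simp
      ultimately have "p ^ j = 1 \<or> p ^ j = 2 \<or> p ^ j = 3" by linarith
      then have "p ^ j dvd 6" by auto
      then show ?thesis using 1 by (simp add: sylow_commuting_bound_def)
    next
      case 2
      then have "real (2 ^ j) < 10" using lt by simp
      \<comment> \<open>Relaxing 10 to 16 loses nothing, since no power of 2 lies from 10 to
        15.\<close>
      then have "real (2 ^ j) < real (2 ^ 4)" by simp
      then have "(2::nat) ^ j < 2 ^ 4" by (simp only: of_nat_less_iff)
      then have "j < 4" using power_less_imp_less_exp[of "2::nat" j 4] by simp
      then have "(2::nat) ^ j dvd 2 ^ 3" by (intro le_imp_power_dvd) simp
      then show ?thesis using 2 by (simp add: sylow_commuting_bound_def)
    next
      case 3
      then show ?thesis by (auto simp: sylow_commuting_bound_def)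
    qed
  qed
  then have "card P dvd sylow_commuting_bound p q * card (P \<inter> centralizer G Q)"
    unfolding j by (intro mult_dvd_mono) simp_all
  then show "\<exists>P Q. sylow_subgroup G p P \<and> sylow_subgroup G q Q \<and>
      card P dvd sylow_commuting_bound p q * card (P \<inter> centralizer G Q)"
    using P Q by blast
qed

theorem theorem1p3:
  fixes G :: "('a, 'b) monoid_scheme"
  assumes "group G" and "finite (carrier G)"
  shows "(\<forall>p1 p2::nat. Factorial_Ring.prime p1 \<and> Factorial_Ring.prime p2 \<and> p1 < p2 \<and> p1 dvd order G \<and> p2 dvd order G
            \<and> (\<forall>r::nat. Factorial_Ring.prime r \<and> r dvd order G \<longrightarrow> p1 \<le> r)
            \<and> (\<forall>r::nat. Factorial_Ring.prime r \<and> r dvd order G \<and> r \<noteq> p1 \<longrightarrow> p2 \<le> r)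
            \<and> pr_star G > (real p1 + real p2 - 1) / (real p1 * real p2)
          \<longrightarrow> nilpotent_group G)
       \<and> (pr_star G > 2 / 3 \<longrightarrow> nilpotent_group G)
       \<and> (pr_star G > 2 / 5 \<longrightarrow> solvable G)"
proof -
  interpret finite_group G using assms by (simp add: finite_group_def finite_group_axioms_def)
  show ?thesis
  proof (intro conjI allI impI; (elim conjE)?)
    fix p1 p2 :: nat
    assume *: "Factorial_Ring.prime p1" "Factorial_Ring.prime p2"
      and min1: "\<forall>r::nat. Factorial_Ring.prime r \<and> r dvd order G \<longrightarrow> p1 \<le> r"
      and min2: "\<forall>r::nat. Factorial_Ring.prime r \<and> r dvd order G \<and> r \<noteq> p1 \<longrightarrow> p2 \<le> r"
      and gt: "pr_star G > (real p1 + real p2 - 1) / (real p1 * real p2)"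
    have "sylows_commute_up_to (\<lambda>_ _. 1) G"
    proof (rule sylows_commute_if_pr_star_gt[OF _ _ _ gt])
      show "p1 \<ge> 1" "p2 \<ge> 1" using * prime_ge_1_nat by blast+
      \<comment> \<open>Of two distinct primes at least one differs from \<open>p1\<close>, and that
        one is at least \<open>p2\<close>.\<close>
      show "p1 \<le> p \<and> p2 \<le> q \<or> p1 \<le> q \<and> p2 \<le> p"
        if "Factorial_Ring.prime p" "Factorial_Ring.prime q" "p \<noteq> q" "p dvd order G" "q dvd order G" for p q
        using that min1 min2 by metis
    qed
    then show "nilpotent_group G" by (rule nilpotent_if_sylows_commute)
  next
    assume gt: "pr_star G > 2 / 3"
    \<comment> \<open>2/3 is the threshold for the primes 2 and 3, which bound any two distinct
      primes from below.\<close>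
    have "sylows_commute_up_to (\<lambda>_ _. 1) G"
    proof (rule sylows_commute_if_pr_star_gt[of 2 3])
      show "2 \<le> p \<and> 3 \<le> q \<or> 2 \<le> q \<and> 3 \<le> p"
        if "Factorial_Ring.prime p" "Factorial_Ring.prime q" "p \<noteq> q" for p q :: nat
        using prime_ge_2_nat[OF that(1)] prime_ge_2_nat[OF that(2)] that(3) by linarith
    qed (use gt in auto)
    then show "nilpotent_group G" by (rule nilpotent_if_sylows_commute)
  next
    assume "pr_star G > 2 / 5"
    then show "solvable G"
      using solvable_if_sylows_almost_commute[OF finite_group_axioms] sylows_almost_commute_if_pr_star_gt
      by blast
  qed
qed

end
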